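(* Let $\beta,\delta\in\mathbb{R}$ satisfy $\beta<\delta\le-\beta$ (so that $\beta<0$). Let $f(s)=\sigma s+cs^2+ds^3$ with real coefficients $\sigma,c,d$ such that $d>0$ and $c^2\le 2d\sigma$. Let $(x_0,y_0,x_1,y_1)\in\mathbb{R}^4$ satisfy $$(3\beta-\delta)x_0y_1+(3\delta-\beta)x_1y_0>(\beta+\delta)(x_0x_1+y_0y_1).$$ If $(x,y)$ is a local solution, in a neighborhood of $t=0$, to the system $$\left\{\begin{array}{l} x''-f(y-x)+\beta(y+x)=0\\ y''-f(y-x)+\delta(y+x)=0\end{array}\right.$$ with initial conditions $x(0)=x_0$, $x'(0)=x_1$, $y(0)=y_0$, $y'(0)=y_1$, then $(x,y)$ blows up in finite time for $t>0$ with self-excited oscillations, that is, there exists $R\in(0,+\infty)$ such that $$\liminf_{t\to R}x(t)=\liminf_{t\to R}y(t)=-\infty\qquad\text{and}\qquad\limsup_{t\to R}x(t)=\limsup_{t\to R}y(t)=+\infty.$$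
   Context: Here $x=x(t)$ and $y=y(t)$ are real-valued functions of the real variable $t$, and primes denote derivatives with respect to $t$. The local solution is understood to be continued forward in time to its maximal interval of existence; $R$ is the finite blow-up time and the limits $t\to R$ are taken from the left. *)

theory Defs
  imports "HOL-Analysis.Analysis"
begin

text \<open>\<open>deriv\<close> is an unspecified value where a function is not differentiable, hence the
  explicit differentiability conditions. The domain \<open>I\<close> is meant to be open, so that derivatives
  at its points do not depend on the values outside \<open>I\<close>.\<close>

definition solves_system ::
  "(real \<Rightarrow> real) \<Rightarrow> real \<Rightarrow> real \<Rightarrow> real set \<Rightarrow> (real \<Rightarrow> real) \<Rightarrow> (real \<Rightarrow> real) \<Rightarrow> bool"
where
  "solves_system f \<beta> \<delta> I x y \<longleftrightarrow>
     (\<forall>t\<in>I.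
        x differentiable (at t) \<and> deriv x differentiable (at t) \<and>
        y differentiable (at t) \<and> deriv y differentiable (at t) \<and>
        deriv (deriv x) t - f (y t - x t) + \<beta> * (y t + x t) = 0 \<and>
        deriv (deriv y) t - f (y t - x t) + \<delta> * (y t + x t) = 0)"

text \<open>\<open>(X, Y)\<close> on \<open>{a<..<R}\<close> continues the solution \<open>(x, y)\<close> on \<open>{a<..<b}\<close> forward in time, and
  cannot itself be continued beyond \<open>R\<close>. The left end point is kept.\<close>

definition maximal_forward_continuation ::
  "(real \<Rightarrow> real) \<Rightarrow> real \<Rightarrow> real \<Rightarrow> real \<Rightarrow> real \<Rightarrow> (real \<Rightarrow> real) \<Rightarrow> (real \<Rightarrow> real) \<Rightarrow>
   real \<Rightarrow> (real \<Rightarrow> real) \<Rightarrow> (real \<Rightarrow> real) \<Rightarrow> bool"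
where
  "maximal_forward_continuation f \<beta> \<delta> a b x y R X Y \<longleftrightarrow>
     b \<le> R \<and>
     solves_system f \<beta> \<delta> {a<..<R} X Y \<and>
     (\<forall>t\<in>{a<..<b}. X t = x t \<and> Y t = y t) \<and>
     \<not> (\<exists>R' X' Y'. R < R' \<and> solves_system f \<beta> \<delta> {a<..<R'} X' Y' \<and>
          (\<forall>t\<in>{a<..<R}. X' t = X t \<and> Y' t = Y t))"

end

theory Submission
  imports Defs
begin

text \<open>
  Put \<open>w = y - x\<close>, \<open>z = y + x\<close>, \<open>\<gamma> = \<delta> - \<beta> > 0\<close> and \<open>\<kappa> = - (\<beta> + \<delta>) \<ge> 0\<close>. The system becomes
  \<open>w'' = - \<gamma> z\<close>, \<open>z'' = 2 f(w) + \<kappa> z\<close>, that is, \<open>w'''' = \<kappa> w'' - 2 \<gamma> f(w)\<close>, and the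
  condition on the initial values says that \<open>G = w' w'' - w w''' + \<kappa> w w'\<close> is positive at
  time 0. There are three reasons for the oscillating blow-up.

  The solution cannot live long (\<open>lifespan_bound\<close>). The derivative
  \<open>G' = w''\<^sup>2 + \<kappa> w'\<^sup>2 + 2 \<gamma> w f(w)\<close> dominates \<open>w''\<^sup>2 + \<gamma> d w\<^sup>4\<close>, because
  \<open>c\<^sup>2 \<le> 2 d \<sigma>\<close> makes \<open>s f(s) \<ge> d s\<^sup>4 / 2\<close>. Thus \<open>G\<close> stays above its positive initial value.
  Moreover \<open>G\<close> is the derivative of \<open>w'\<^sup>2 - w w'' + \<kappa> w\<^sup>2 / 2\<close>. Integrate \<open>(G' + G) \<phi>\<close> by
  parts with a bump function \<open>\<phi>\<close> spread over \<open>[0, L]\<close>. All terms that contain derivatives of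
  \<open>\<phi>\<close> can be absorbed in \<open>G' \<phi>\<close> up to an error of order \<open>1 / L\<close>, whereas \<open>G \<phi>\<close> contributes
  at least a multiple of \<open>L\<close>. This bounds \<open>L\<close> by a constant that depends on the equation and
  on \<open>G(0)\<close> only.

  At the end \<open>R\<close> of the maximal interval, which is finite by this bound, the phase curve
  \<open>(x, x', y, y')\<close> is unbounded (\<open>maximal_integral_curve\<close>). This is the usual consequence of
  local existence and uniqueness for a locally Lipschitz vector field.

  Unboundedness at a finite time forces oscillation (\<open>oscillation_of_unbounded_curve\<close>). If one of
  \<open>x = (z - w) / 2\<close> and \<open>y = (z + w) / 2\<close> is bounded on one side near \<open>R\<close>, then
  \<open>w'' = - \<gamma> z\<close> turns this into \<open>w'' \<ge> \<theta> w - C\<close>, or the same for \<open>- w\<close>, with \<open>\<theta> = \<plusminus> \<gamma>\<close>.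
  On a short interval such an inequality bounds \<open>w\<close> below. Then \<open>f(w)\<close> is bounded below as \<open>f\<close> is
  increasing, so \<open>z'' \<ge> \<kappa> z - C\<close> bounds \<open>z\<close> below, so \<open>w'' = - \<gamma> z\<close> bounds \<open>w\<close> above, and
  finally everything is bounded, a contradiction.
\<close>

section \<open>Integral curves of locally Lipschitz vector fields\<close>

definition integral_curve :: "('a::real_normed_vector \<Rightarrow> 'a) \<Rightarrow> real set \<Rightarrow> (real \<Rightarrow> 'a) \<Rightarrow> bool"
  where "integral_curve V S u \<longleftrightarrow> (\<forall>t\<in>S. (u has_vector_derivative V (u t)) (at t within S))"

lemma integral_curve_subset:
  "integral_curve V S u \<Longrightarrow> T \<subseteq> S \<Longrightarrow> integral_curve V T u"
  unfolding integral_curve_def using has_vector_derivative_within_subset by blast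

lemma integral_curve_open:
  "open S \<Longrightarrow> integral_curve V S u \<longleftrightarrow> (\<forall>t\<in>S. (u has_vector_derivative V (u t)) (at t))"
  unfolding integral_curve_def by (metis has_vector_derivative_within_open)

lemma integral_curve_continuous_on:
  "integral_curve V S u \<Longrightarrow> continuous_on S u"
  unfolding integral_curve_def
  using has_vector_derivative_continuous continuous_on_eq_continuous_within by blast

lemma integral_curve_shift:
  assumes "integral_curve V {0..h} u"
  shows "integral_curve V {s..s+h} (\<lambda>t. u (t - s))"
  unfolding integral_curve_def
proof
  fix t assume t: "t \<in> {s..s+h}"
  have eq: "(\<lambda>t. t - s) ` {s..s+h} = {0..h}"
  proof (intro equalityI subsetI)
    fix r assume "r \<in> {0..h}"
    then show "r \<in> (\<lambda>t. t - s) ` {s..s+h}" by (intro image_eqI[of _ _ "r + s"]) auto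
  qed auto
  have "((\<lambda>t. t - s) has_vector_derivative 1) (at t within {s..s+h})"
    by (auto intro!: derivative_eq_intros)
  moreover have "(u has_vector_derivative V (u (t - s))) (at (t - s) within (\<lambda>t. t - s) ` {s..s+h})"
    using assms t by (simp add: integral_curve_def eq)
  ultimately have "((u \<circ> (\<lambda>t. t - s)) has_vector_derivative (1 *\<^sub>R V (u (t - s)))) (at t within {s..s+h})"
    by (rule vector_diff_chain_within)
  then show "((\<lambda>t. u (t - s)) has_vector_derivative V (u (t - s))) (at t within {s..s+h})"
    by (simp add: o_def)
qed

definition lipschitz_on_balls :: "('a::real_normed_vector \<Rightarrow> 'b::real_normed_vector) \<Rightarrow> bool"
  where "lipschitz_on_balls V \<longleftrightarrow> (\<forall>M. \<exists>L. L-lipschitz_on (cball 0 M) V)"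

text \<open>The existence time depends only on a bound for the initial value, not on the initial value itself.
This uniformity is what turns a bounded solution into one that can be continued: restarting it
close enough to its right end point overshoots that point.\<close>

lemma picard_uniform_time:
  fixes V :: "'a::banach \<Rightarrow> 'a"
  assumes "lipschitz_on_balls V"
  obtains h where "h > 0"
    "\<And>u0. norm u0 \<le> M \<Longrightarrow> \<exists>u. u 0 = u0 \<and> integral_curve V {0..h} u"
proof -
  obtain L where L: "L-lipschitz_on (cball 0 (M + 1)) V"
    using assms unfolding lipschitz_on_balls_def by blast
  have L0: "L \<ge> 0" using L by (rule lipschitz_on_nonneg)
  define B where "B = norm (V 0) + L * (\<bar>M\<bar> + 1)"
  have B0: "B \<ge> 0" unfolding B_def using L0 by simp
  define h where "h = 1 / (2 * (L + B + 1))"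
  have h0: "h > 0" unfolding h_def using L0 B0 by simp
  have Lh: "L * h \<le> 1/2" and Bh: "B * h \<le> 1"
    unfolding h_def using L0 B0 by (simp_all add: field_simps)
  have "\<exists>u. u 0 = u0 \<and> integral_curve V {0..h} u" if u0: "norm u0 \<le> M" for u0
  proof -
    have M0: "M \<ge> 0" using u0 norm_ge_zero[of u0] by linarith
    have ball: "cball u0 1 \<subseteq> cball 0 (M + 1)"
    proof
      fix v assume "v \<in> cball u0 1"
      then show "v \<in> cball 0 (M + 1)"
        using u0 norm_triangle_sub[of v u0] by (simp add: dist_norm norm_minus_commute)
    qed
    have VL: "norm (V p - V q) \<le> L * norm (p - q)" if "p \<in> cball u0 1" "q \<in> cball u0 1" for p q
      using lipschitz_onD[OF L, of p q] that ball by (simp add: dist_norm subset_iff)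
    have VB: "norm (V p) \<le> B" if "p \<in> cball u0 1" for p
    proof -
      have p: "p \<in> cball 0 (M + 1)" using that ball by blast
      have "norm (V p - V 0) \<le> L * norm (p - 0)"
        using lipschitz_onD[OF L p, of 0] M0 by (auto simp: dist_norm)
      also have "\<dots> \<le> L * (\<bar>M\<bar> + 1)" using p L0 by (intro mult_left_mono) auto
      finally show ?thesis unfolding B_def using norm_triangle_sub[of "V p" "V 0"] by linarith
    qed
    have contV: "continuous_on (cball u0 1) V"
      using lipschitz_on_subset[OF L ball] by (rule lipschitz_on_continuous_on)
    define X where "X = PiC UNIV (\<lambda>_::real. cball u0 1)"
    have Xmem: "v \<in> X \<longleftrightarrow> (\<forall>t. apply_bcontfun v t \<in> cball u0 1)" for v
      unfolding X_def mem_PiC_iff by auto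
    \<comment> \<open>Bounded continuous functions on the whole line form a complete space; clamping the upper limit of
      integration to \<open>[0, h]\<close> makes the Picard operator act there.\<close>
    define c :: "real \<Rightarrow> real" where "c t = max 0 (min h t)" for t
    have c: "0 \<le> c t" "c t \<le> h" for t unfolding c_def using h0 by auto
    define T where
      "T v = (\<lambda>t. u0 + integral {0..c t} (\<lambda>s. V (apply_bcontfun v s)))" for v
    have cont: "continuous_on S (\<lambda>s. V (apply_bcontfun v s))" if "v \<in> X" for v S
      by (rule continuous_on_compose2[OF contV]) (use that Xmem in auto)
    have Tball: "T v t \<in> cball u0 1" if "v \<in> X" for v t
    proof -
      have "norm (integral {0..c t} (\<lambda>s. V (apply_bcontfun v s))) \<le> B * (c t - 0)"
        using that Xmem by (intro integral_bound cont VB c) auto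
      also have "\<dots> \<le> B * h" using c[of t] B0 by (intro mult_left_mono) auto
      finally show ?thesis using Bh by (simp add: T_def dist_norm)
    qed
    have Tcont: "continuous_on UNIV (T v)" if "v \<in> X" for v
    proof -
      have *: "continuous_on {0..h} (\<lambda>r. integral {0..r} (\<lambda>s. V (apply_bcontfun v s)))"
        by (intro indefinite_integral_continuous_1 integrable_continuous_real cont that)
      have "continuous_on UNIV c" unfolding c_def by (intro continuous_intros)
      then have "continuous_on UNIV (\<lambda>t. integral {0..c t} (\<lambda>s. V (apply_bcontfun v s)))"
        by (rule continuous_on_compose2[OF *]) (use c in auto)
      then show ?thesis unfolding T_def by (intro continuous_intros)
    qed
    have Tb: "T v \<in> bcontfun" if "v \<in> X" for v
    proof (rule bcontfun_normI[OF Tcont[OF that]])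
      fix t show "norm (T v t) \<le> M + 1" using Tball[OF that, of t] ball by auto
    qed
    have app: "apply_bcontfun (Bcontfun (T v)) = T v" if "v \<in> X" for v
      using Tb[OF that] by (simp add: Bcontfun_inverse)
    have "\<exists>!v\<in>X. Bcontfun (T v) = v"
    proof (rule Banach_fix[of X "1/2" "\<lambda>v. Bcontfun (T v)"])
      show "complete X" unfolding X_def
        by (simp add: complete_eq_closed closed_PiC)
      have "const_bcontfun u0 \<in> X" by (simp add: Xmem const_bcontfun.rep_eq)
      then show "X \<noteq> {}" by blast
      show "(\<lambda>v. Bcontfun (T v)) ` X \<subseteq> X"
        using app Tball by (auto simp: Xmem[of "Bcontfun _"])
      fix v w assume vw: "v \<in> X" "w \<in> X"
      show "dist (Bcontfun (T v)) (Bcontfun (T w)) \<le> 1/2 * dist v w"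
      proof (rule dist_bound)
        fix t
        have "dist (T v t) (T w t)
            = norm (integral {0..c t} (\<lambda>s. V (apply_bcontfun v s) - V (apply_bcontfun w s)))"
          using vw unfolding T_def
          by (simp add: dist_norm integral_diff integrable_continuous_real cont)
        also have "\<dots> \<le> (L * dist v w) * (c t - 0)"
        proof (intro integral_bound c continuous_on_diff cont vw)
          fix s assume "s \<in> {0..c t}"
          show "norm (V (apply_bcontfun v s) - V (apply_bcontfun w s)) \<le> L * dist v w"
          proof -
            have "norm (V (apply_bcontfun v s) - V (apply_bcontfun w s))
                \<le> L * norm (apply_bcontfun v s - apply_bcontfun w s)"
              using vw Xmem by (intro VL) auto
            also have "\<dots> \<le> L * dist v w"
              using dist_bounded[of v s w] L0 by (intro mult_left_mono) (auto simp: dist_norm)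
            finally show ?thesis .
          qed
        qed
        also have "\<dots> \<le> (L * dist v w) * h" using L0 c[of t] by (intro mult_left_mono) auto
        also have "\<dots> = (L * h) * dist v w" by simp
        also have "\<dots> \<le> 1/2 * dist v w" using Lh by (intro mult_right_mono) auto
        finally show "dist (apply_bcontfun (Bcontfun (T v)) t) (apply_bcontfun (Bcontfun (T w)) t)
            \<le> 1/2 * dist v w" by (simp add: app vw)
      qed
    qed auto
    then obtain v where v: "v \<in> X" "Bcontfun (T v) = v" by blast
    have veq: "apply_bcontfun v = T v" using app[OF v(1)] v(2) by simp
    have veq': "apply_bcontfun v t = u0 + integral {0..t} (\<lambda>s. V (apply_bcontfun v s))"
      if "t \<in> {0..h}" for t
      using that by (subst veq) (simp add: T_def c_def)
    have "integral_curve V {0..h} (apply_bcontfun v)"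
      unfolding integral_curve_def
    proof
      fix t assume t: "t \<in> {0..h}"
      have "((\<lambda>r. u0 + integral {0..r} (\<lambda>s. V (apply_bcontfun v s)))
          has_vector_derivative V (apply_bcontfun v t)) (at t within {0..h})"
        using integral_has_vector_derivative[OF cont[OF v(1)] t]
        by (auto intro!: derivative_eq_intros)
      then show "(apply_bcontfun v has_vector_derivative V (apply_bcontfun v t)) (at t within {0..h})"
        by (rule has_vector_derivative_transform[rotated 2]) (use t veq' in auto)
    qed
    moreover have "apply_bcontfun v 0 = u0" using veq'[of 0] h0 by simp
    ultimately show ?thesis by blast
  qed
  with h0 show thesis using that by blast
qed

text \<open>The squared distance of two curves, damped by the Lipschitz constant on a ball that contains both,
cannot increase.\<close>

lemma integral_curve_unique:
  fixes V :: "'a::real_inner \<Rightarrow> 'a"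
  assumes V: "lipschitz_on_balls V"
    and u: "integral_curve V {s..e} u" and v: "integral_curve V {s..e} v"
    and init: "u s = v s" and t: "t \<in> {s..e}"
  shows "u t = v t"
proof -
  have "bounded (u ` {s..e} \<union> v ` {s..e})"
    by (intro compact_imp_bounded compact_Un compact_continuous_image compact_Icc
        integral_curve_continuous_on[OF u] integral_curve_continuous_on[OF v])
  then obtain M where "\<forall>p\<in>u ` {s..e} \<union> v ` {s..e}. norm p \<le> M"
    unfolding bounded_iff by blast
  then have M: "norm (u r) \<le> M \<and> norm (v r) \<le> M" if "r \<in> {s..e}" for r
    using that by blast
  obtain L where L: "L-lipschitz_on (cball 0 M) V"
    using V unfolding lipschitz_on_balls_def by blast
  define w where "w r = u r - v r" for r
  define g where "g r = exp (-2 * L * r) * (w r \<bullet> w r)" for r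
  have g': "(g has_real_derivative exp (-2 * L * r)
      * (2 * (w r \<bullet> (V (u r) - V (v r))) - 2 * L * (w r \<bullet> w r))) (at r within {s..e})"
    if r: "r \<in> {s..e}" for r
  proof -
    have w': "(w has_vector_derivative V (u r) - V (v r)) (at r within {s..e})"
      unfolding w_def using u v r
      by (auto simp: integral_curve_def intro!: derivative_eq_intros)
    have "((\<lambda>r. w r \<bullet> w r) has_vector_derivative
        w r \<bullet> (V (u r) - V (v r)) + (V (u r) - V (v r)) \<bullet> w r) (at r within {s..e})"
      using bounded_bilinear.has_vector_derivative[OF bounded_bilinear_inner w' w'] .
    then have "((\<lambda>r. w r \<bullet> w r) has_real_derivative
        2 * (w r \<bullet> (V (u r) - V (v r)))) (at r within {s..e})"
      by (simp add: has_real_derivative_iff_has_vector_derivative inner_commute)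
    then show ?thesis unfolding g_def
      by (auto intro!: derivative_eq_intros simp: algebra_simps)
  qed
  have "g t \<le> g s"
  proof (rule DERIV_nonpos_imp_decreasing_open[of s t g])
    show "s \<le> t" using t by simp
    have "continuous_on {s..e} g"
      using g' by (meson DERIV_continuous continuous_on_eq_continuous_within)
    then show "continuous_on {s..t} g"
      by (rule continuous_on_subset) (use t in auto)
    fix r assume r: "s < r" "r < t"
    then have r': "r \<in> {s..e}" using t by auto
    have "norm (V (u r) - V (v r)) \<le> L * norm (w r)"
      unfolding w_def using lipschitz_onD[OF L, of "u r" "v r"] M[OF r'] by (auto simp: dist_norm)
    then have "norm (w r) * norm (V (u r) - V (v r)) \<le> norm (w r) * (L * norm (w r))"
      by (intro mult_left_mono) auto
    then have "w r \<bullet> (V (u r) - V (v r)) \<le> norm (w r) * (L * norm (w r))"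
      using norm_cauchy_schwarz[of "w r" "V (u r) - V (v r)"] by linarith
    also have "\<dots> = L * (w r \<bullet> w r)" by (simp add: dot_square_norm power2_eq_square)
    finally have "exp (-2 * L * r) * (2 * (w r \<bullet> (V (u r) - V (v r))) - 2 * L * (w r \<bullet> w r)) \<le> 0"
      by (intro mult_nonneg_nonpos) auto
    moreover have "at r within {s..e} = at r"
      using r t by (intro at_within_interior) auto
    ultimately show "\<exists>y. DERIV g r :> y \<and> y \<le> 0" using g'[OF r'] by auto
  qed
  also have "g s = 0" using init by (simp add: g_def w_def)
  finally have "w t \<bullet> w t \<le> 0" by (simp add: g_def mult_le_0_iff)
  then have "w t = 0" using inner_gt_zero_iff[of "w t"] by linarith
  then show ?thesis by (simp add: w_def)
qed

lemma extensions_agree: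
  fixes V :: "'a::real_inner \<Rightarrow> 'a"
  assumes V: "lipschitz_on_balls V" and "a < b"
    and u: "integral_curve V {a<..<r} u" and v: "integral_curve V {a<..<r'} v"
    and eq: "\<And>t. t \<in> {a<..<b} \<Longrightarrow> u t = v t"
    and t: "a < t" "t < r" "t < r'"
  shows "u t = v t"
proof (cases "t < b")
  case True then show ?thesis using eq t by auto
next
  case False
  define s where "s = (a + b) / 2"
  have s: "a < s" "s < b" "s < t" unfolding s_def using \<open>a < b\<close> False by auto
  show ?thesis
  proof (rule integral_curve_unique[OF V, of s t])
    show "integral_curve V {s..t} u" by (rule integral_curve_subset[OF u]) (use s t in auto)
    show "integral_curve V {s..t} v" by (rule integral_curve_subset[OF v]) (use s t in auto)
    show "u s = v s" using eq s by auto
  qed (use s in auto)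
qed

lemma integral_curve_local:
  assumes "open S" and "\<And>t. t \<in> S \<Longrightarrow> \<exists>T v. open T \<and> t \<in> T \<and> integral_curve V T v \<and> (\<forall>r\<in>T. v r = u r)"
  shows "integral_curve V S u"
  unfolding integral_curve_open[OF \<open>open S\<close>]
proof
  fix t assume "t \<in> S"
  then obtain T v where T: "open T" "t \<in> T" "integral_curve V T v" "\<forall>r\<in>T. v r = u r"
    using assms by blast
  then have "(v has_vector_derivative V (u t)) (at t)"
    using integral_curve_open by metis
  then show "(u has_vector_derivative V (u t)) (at t)"
    using T by (auto intro: has_vector_derivative_transform_within_open[of v _ t T u])
qed

text \<open>By uniqueness all continuations of \<open>u0\<close> agree where they overlap, so they glue together
up to the supremum \<open>R\<close> of their end points. The curve cannot stay bounded near \<open>R\<close>, since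
otherwise the uniform existence time would carry it past \<open>R\<close>.\<close>

theorem maximal_integral_curve:
  fixes V :: "'a::euclidean_space \<Rightarrow> 'a"
  assumes V: "lipschitz_on_balls V" and ab: "a < b"
    and u0: "integral_curve V {a<..<b} u0"
    and bound: "\<And>r u. b \<le> r \<Longrightarrow> integral_curve V {a<..<r} u \<Longrightarrow> (\<forall>t\<in>{a<..<b}. u t = u0 t) \<Longrightarrow> r \<le> L"
  obtains R u where "b \<le> R" "integral_curve V {a<..<R} u" "\<forall>t\<in>{a<..<b}. u t = u0 t"
    "\<And>R' u'. R < R' \<Longrightarrow> integral_curve V {a<..<R'} u' \<Longrightarrow> (\<forall>t\<in>{a<..<b}. u' t = u0 t) \<Longrightarrow> False"
    "\<And>M. \<not> (\<forall>\<^sub>F t in at_left R. norm (u t) \<le> M)"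
proof -
  define E where "E r v \<longleftrightarrow> b \<le> r \<and> integral_curve V {a<..<r} v \<and> (\<forall>t\<in>{a<..<b}. v t = u0 t)" for r v
  define A where "A = {r. \<exists>v. E r v}"
  have bA: "b \<in> A" unfolding A_def E_def using u0 by auto
  have bdd: "bdd_above A" using bound by (auto simp: A_def E_def intro!: bdd_aboveI[of _ L])
  define R where "R = Sup A"
  have bR: "b \<le> R" unfolding R_def using bA bdd by (rule cSup_upper)
  have ex: "\<exists>r v. t < r \<and> E r v" if "t < R" for t
    using that less_cSup_iff[OF _ bdd] bA unfolding R_def A_def by auto
  define u where "u t = (SOME p. \<exists>r v. t < r \<and> E r v \<and> p = v t)" for t
  have u: "u t = v t" if "a < t" "t < r" "E r v" for t r v
  proof -
    have "\<exists>p r v. t < r \<and> E r v \<and> p = v t" using that by blast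
    then have "\<exists>r v. t < r \<and> E r v \<and> u t = v t" unfolding u_def by (rule someI_ex)
    then obtain r' v' where v': "t < r'" "E r' v'" "u t = v' t" by blast
    have "v' t = v t"
      by (rule extensions_agree[OF V ab, of r' v' r v]) (use v' that in \<open>auto simp: E_def\<close>)
    then show ?thesis using v' by simp
  qed
  have curve: "integral_curve V {a<..<R} u"
  proof (rule integral_curve_local)
    fix t assume t: "t \<in> {a<..<R}"
    then obtain r v where rv: "t < r" "E r v" using ex[of t] by auto
    have "\<forall>q\<in>{a<..<r}. v q = u q" using u[OF _ _ rv(2)] by simp
    then show "\<exists>T v. open T \<and> t \<in> T \<and> integral_curve V T v \<and> (\<forall>r\<in>T. v r = u r)"
      using t rv by (intro exI[of _ "{a<..<r}"] exI[of _ v]) (simp add: E_def)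
  qed simp
  have "E b u0" using u0 by (simp add: E_def)
  then have agree: "\<forall>t\<in>{a<..<b}. u t = u0 t"
    using u[of _ b u0] by simp
  have max: False if "R < R'" "integral_curve V {a<..<R'} u'" "\<forall>t\<in>{a<..<b}. u' t = u0 t" for R' u'
  proof -
    have "R' \<in> A" unfolding A_def E_def using that bR by auto
    then have "R' \<le> R" unfolding R_def using bdd by (rule cSup_upper)
    then show False using that by simp
  qed
  have unbounded: "\<not> (\<forall>\<^sub>F t in at_left R. norm (u t) \<le> M)" for M
  proof
    assume "\<forall>\<^sub>F t in at_left R. norm (u t) \<le> M"
    then obtain s where s: "s < R" "\<And>t. s < t \<Longrightarrow> t < R \<Longrightarrow> norm (u t) \<le> M"
      by (auto simp: eventually_at_left_field)
    obtain h where h: "h > 0"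
      "\<And>p. norm p \<le> M \<Longrightarrow> \<exists>v. v 0 = p \<and> integral_curve V {0..h} v"
      using picard_uniform_time[OF V] by blast
    \<comment> \<open>Restart at a time \<open>t1\<close> that lies in the bounded stretch and less than \<open>h\<close> before \<open>R\<close>.\<close>
    define t1 where "t1 = (max (max s a) (R - h) + R) / 2"
    have t1: "s < t1" "a < t1" "t1 < R" "R < t1 + h"
      using s(1) ab bR h(1) by (simp_all add: t1_def max_def field_simps)
    obtain v0 where "v0 0 = u t1" "integral_curve V {0..h} v0"
      using h(2)[OF s(2)[OF t1(1,3)]] by blast
    define v where "v t = v0 (t - t1)" for t
    have v: "v t1 = u t1" "integral_curve V {t1..t1+h} v"
      using \<open>v0 0 = u t1\<close> integral_curve_shift[OF \<open>integral_curve V {0..h} v0\<close>, of t1]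
      by (simp_all add: v_def[abs_def])
    have uv: "u t = v t" if "t1 \<le> t" "t < R" for t
    proof (rule integral_curve_unique[OF V, of t1 t])
      show "integral_curve V {t1..t} u"
        by (rule integral_curve_subset[OF curve]) (use that t1 in auto)
      show "integral_curve V {t1..t} v"
        by (rule integral_curve_subset[OF v(2)]) (use that t1 in auto)
    qed (use v that in auto)
    \<comment> \<open>The two pieces coincide on all of \<open>[t1, R)\<close>, so near every time the glued function is
      one of them and no matching of derivatives at a joint arises.\<close>
    define u' where "u' t = (if t < R then u t else v t)" for t
    have "integral_curve V {a<..<t1+h} u'"
    proof (rule integral_curve_local)
      fix t assume t: "t \<in> {a<..<t1+h}"
      show "\<exists>T v. open T \<and> t \<in> T \<and> integral_curve V T v \<and> (\<forall>r\<in>T. v r = u' r)"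
      proof (cases "t < R")
        case True
        then show ?thesis using t curve
          by (intro exI[of _ "{a<..<R}"] exI[of _ u]) (auto simp: u'_def)
      next
        case False
        have "integral_curve V {t1<..<t1+h} v"
          by (rule integral_curve_subset[OF v(2)]) auto
        then show ?thesis using t t1 False uv
          by (intro exI[of _ "{t1<..<t1+h}"] exI[of _ v]) (auto simp: u'_def)
      qed
    qed simp
    moreover have "\<forall>t\<in>{a<..<b}. u' t = u0 t" using agree bR by (auto simp: u'_def)
    ultimately show False using max t1 by blast
  qed
  show thesis by (rule that[OF bR curve agree max unbounded])
qed

lemma lipschitz_on_ballsI:
  "(\<And>M. \<exists>L. L-lipschitz_on (cball 0 M) V) \<Longrightarrow> lipschitz_on_balls V"
  unfolding lipschitz_on_balls_def by blast

lemma lipschitz_on_balls_compose_linear: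
  fixes f :: "'b::real_normed_vector \<Rightarrow> 'c::real_normed_vector"
    and A :: "'a::real_normed_vector \<Rightarrow> 'b"
  assumes f: "lipschitz_on_balls f" and A: "bounded_linear A"
  shows "lipschitz_on_balls (\<lambda>u. f (A u))"
proof (rule lipschitz_on_ballsI)
  fix M
  obtain B where B: "B-lipschitz_on UNIV A"
    using bounded_linear.lipschitz_boundE[OF A] by metis
  obtain K where K: "K \<ge> 0" "\<And>u. norm (A u) \<le> norm u * K"
    using bounded_linear.nonneg_bounded[OF A] by blast
  obtain L where L: "L-lipschitz_on (cball 0 (\<bar>M\<bar> * K)) f"
    using f unfolding lipschitz_on_balls_def by blast
  have "A ` cball 0 M \<subseteq> cball 0 (\<bar>M\<bar> * K)"
  proof (clarsimp)
    fix u :: 'a assume "norm u \<le> M"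
    then have "norm u * K \<le> \<bar>M\<bar> * K" using K(1) by (intro mult_right_mono) auto
    then show "norm (A u) \<le> \<bar>M\<bar> * K" using K(2)[of u] by linarith
  qed
  then have "L-lipschitz_on (A ` cball 0 M) f" using L lipschitz_on_subset by blast
  then have "(L * B)-lipschitz_on (cball 0 M) (\<lambda>u. f (A u))"
    using lipschitz_on_subset[OF B] by (intro lipschitz_on_compose2) auto
  then show "\<exists>L. L-lipschitz_on (cball 0 M) (\<lambda>u. f (A u))" by blast
qed

lemma lipschitz_on_balls_linear:
  assumes "bounded_linear A"
  shows "lipschitz_on_balls A"
proof (rule lipschitz_on_ballsI)
  fix M
  obtain B where "B-lipschitz_on UNIV A"
    using bounded_linear.lipschitz_boundE[OF assms] by metis
  then show "\<exists>L. L-lipschitz_on (cball 0 M) A" using lipschitz_on_subset by blast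
qed

lemma lipschitz_on_balls_diff:
  assumes "lipschitz_on_balls f" "lipschitz_on_balls g"
  shows "lipschitz_on_balls (\<lambda>u. f u - g u)"
proof (rule lipschitz_on_ballsI)
  fix M
  obtain A B where "A-lipschitz_on (cball 0 M) f" "B-lipschitz_on (cball 0 M) g"
    using assms unfolding lipschitz_on_balls_def by blast
  then show "\<exists>L. L-lipschitz_on (cball 0 M) (\<lambda>u. f u - g u)" using lipschitz_on_diff by blast
qed

lemma lipschitz_on_balls_Pair:
  assumes "lipschitz_on_balls f" "lipschitz_on_balls g"
  shows "lipschitz_on_balls (\<lambda>u. (f u, g u))"
proof (rule lipschitz_on_ballsI)
  fix M
  obtain A B where "A-lipschitz_on (cball 0 M) f" "B-lipschitz_on (cball 0 M) g"
    using assms unfolding lipschitz_on_balls_def by blast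
  then show "\<exists>L. L-lipschitz_on (cball 0 M) (\<lambda>u. (f u, g u))" using lipschitz_on_Pair by blast
qed

section \<open>A bound for the lifespan\<close>

text \<open>With \<open>p = w'\<close>, \<open>z = - w'' / \<gamma>\<close> and \<open>q = z'\<close> the system is \<open>w'''' = \<kappa> w'' - 2 \<gamma> f(w)\<close>, and
\<open>G = w' w'' - w w''' + \<kappa> w w'\<close> is the quantity whose positivity at the initial time causes the blow-up.
Its derivative is nonnegative if \<open>\<gamma>\<close>, \<open>\<kappa>\<close> and all \<open>s f(s)\<close> are, and \<open>G\<close> is itself the derivative of
\<open>\<Psi> = w'\<^sup>2 - w w'' + \<kappa> w\<^sup>2 / 2\<close>. Hence \<open>G'\<close> and \<open>G\<close> can be tested
against the same function \<open>\<phi>\<^sub>0\<close> and integrated by parts until no derivative of \<open>w\<close> other than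
\<open>w''\<close>, which \<open>G'\<close> controls, is left next to a derivative of \<open>\<phi>\<^sub>0\<close>. The second claim is this
integration by parts in differential form: the function on the left collects the boundary terms.\<close>

lemma virial_identity:
  fixes \<gamma> \<kappa> t :: real and w p z q f \<phi>\<^sub>0 \<phi>\<^sub>1 \<phi>\<^sub>2 \<phi>\<^sub>3 :: "real \<Rightarrow> real"
  defines "G \<equiv> \<lambda>t. \<gamma> * (w t * q t - p t * z t) + \<kappa> * w t * p t"
  defines "\<Psi> \<equiv> \<lambda>t. p t ^ 2 + \<gamma> * w t * z t + \<kappa> / 2 * w t ^ 2"
  assumes w: "(w has_real_derivative p t) (at t)"
    and p: "(p has_real_derivative - (\<gamma> * z t)) (at t)"
    and z: "(z has_real_derivative q t) (at t)"
    and q: "(q has_real_derivative 2 * f (w t) + \<kappa> * z t) (at t)"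
    and \<phi>: "(\<phi>\<^sub>0 has_real_derivative \<phi>\<^sub>1 t) (at t)" "(\<phi>\<^sub>1 has_real_derivative \<phi>\<^sub>2 t) (at t)"
      "(\<phi>\<^sub>2 has_real_derivative \<phi>\<^sub>3 t) (at t)" "(\<phi>\<^sub>3 has_real_derivative \<phi>\<^sub>4) (at t)"
  shows "(G has_real_derivative (\<gamma> * z t) ^ 2 + \<kappa> * p t ^ 2 + 2 * \<gamma> * (w t * f (w t))) (at t)"
    and "((\<lambda>t. G t * \<phi>\<^sub>0 t + \<Psi> t * (\<phi>\<^sub>0 t - \<phi>\<^sub>1 t) + w t * p t * (\<phi>\<^sub>2 t - \<phi>\<^sub>1 t)
           - w t ^ 2 / 2 * (\<phi>\<^sub>3 t - \<phi>\<^sub>2 t)) has_real_derivative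
          ((\<gamma> * z t) ^ 2 + \<kappa> * p t ^ 2 + 2 * \<gamma> * (w t * f (w t)) + G t) * \<phi>\<^sub>0 t
          - 2 * w t * (\<gamma> * z t) * (\<phi>\<^sub>2 t - \<phi>\<^sub>1 t) - \<kappa> / 2 * w t ^ 2 * (\<phi>\<^sub>2 t - \<phi>\<^sub>1 t)
          - w t ^ 2 / 2 * (\<phi>\<^sub>4 - \<phi>\<^sub>3 t)) (at t)"
proof -
  show G: "(G has_real_derivative (\<gamma> * z t) ^ 2 + \<kappa> * p t ^ 2 + 2 * \<gamma> * (w t * f (w t))) (at t)"
    unfolding G_def
    by (rule derivative_eq_intros w p z q refl)+ (simp add: algebra_simps power2_eq_square)
  have \<Psi>: "(\<Psi> has_real_derivative G t) (at t)"
    unfolding G_def \<Psi>_def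
    by (rule derivative_eq_intros w p z q refl)+ (simp add: algebra_simps power2_eq_square)
  show "((\<lambda>t. G t * \<phi>\<^sub>0 t + \<Psi> t * (\<phi>\<^sub>0 t - \<phi>\<^sub>1 t) + w t * p t * (\<phi>\<^sub>2 t - \<phi>\<^sub>1 t)
           - w t ^ 2 / 2 * (\<phi>\<^sub>3 t - \<phi>\<^sub>2 t)) has_real_derivative
          ((\<gamma> * z t) ^ 2 + \<kappa> * p t ^ 2 + 2 * \<gamma> * (w t * f (w t)) + G t) * \<phi>\<^sub>0 t
          - 2 * w t * (\<gamma> * z t) * (\<phi>\<^sub>2 t - \<phi>\<^sub>1 t) - \<kappa> / 2 * w t ^ 2 * (\<phi>\<^sub>2 t - \<phi>\<^sub>1 t)
          - w t ^ 2 / 2 * (\<phi>\<^sub>4 - \<phi>\<^sub>3 t)) (at t)"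
  proof (rule DERIV_cong)
    have w2: "((\<lambda>t. w t ^ 2 / 2) has_real_derivative w t * p t) (at t)"
      using DERIV_cdivide[OF DERIV_mult[OF w w], of 2] by (simp add: power2_eq_square mult.commute)
    show "((\<lambda>t. G t * \<phi>\<^sub>0 t + \<Psi> t * (\<phi>\<^sub>0 t - \<phi>\<^sub>1 t) + w t * p t * (\<phi>\<^sub>2 t - \<phi>\<^sub>1 t)
           - w t ^ 2 / 2 * (\<phi>\<^sub>3 t - \<phi>\<^sub>2 t)) has_real_derivative
        ((\<gamma> * z t) ^ 2 + \<kappa> * p t ^ 2 + 2 * \<gamma> * (w t * f (w t))) * \<phi>\<^sub>0 t + \<phi>\<^sub>1 t * G t
        + (G t * (\<phi>\<^sub>0 t - \<phi>\<^sub>1 t) + (\<phi>\<^sub>1 t - \<phi>\<^sub>2 t) * \<Psi> t)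
        + ((p t * p t + - (\<gamma> * z t) * w t) * (\<phi>\<^sub>2 t - \<phi>\<^sub>1 t) + (\<phi>\<^sub>3 t - \<phi>\<^sub>2 t) * (w t * p t))
        - (w t * p t * (\<phi>\<^sub>3 t - \<phi>\<^sub>2 t) + (\<phi>\<^sub>4 - \<phi>\<^sub>3 t) * (w t ^ 2 / 2))) (at t)"
      by (intro DERIV_diff DERIV_add DERIV_mult G \<Psi> w p w2 \<phi>)
  qed (simp add: \<Psi>_def algebra_simps power2_eq_square diff_divide_distrib add_divide_distrib)
qed

text \<open>The test function \<open>P\<^sup>8\<close> vanishes at both ends of \<open>[0, L]\<close>, where \<open>L = 1 / \<epsilon>\<close>. Each derivative costs one factor
\<open>P\<close> and gains one factor \<open>\<epsilon>\<close>. The power 8 is the smallest that leaves \<open>P\<^sup>4\<close>, the square root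
of the test function, after four derivatives, as the absorption below requires.\<close>

lemma bump_function:
  fixes \<epsilon> L :: real and P :: "real \<Rightarrow> real"
  assumes \<epsilon>: "0 < \<epsilon>" "\<epsilon> \<le> 1" and \<epsilon>L: "\<epsilon> * L = 1"
    and P_eq: "\<And>t. P t = \<epsilon> * t * (1 - \<epsilon> * t)"
  obtains \<phi>\<^sub>1 \<phi>\<^sub>2 \<phi>\<^sub>3 \<phi>\<^sub>4 :: "real \<Rightarrow> real" where
    "\<And>t. ((\<lambda>t. P t ^ 8) has_real_derivative \<phi>\<^sub>1 t) (at t)"
    "\<And>t. (\<phi>\<^sub>1 has_real_derivative \<phi>\<^sub>2 t) (at t)"
    "\<And>t. (\<phi>\<^sub>2 has_real_derivative \<phi>\<^sub>3 t) (at t)"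
    "\<And>t. (\<phi>\<^sub>3 has_real_derivative \<phi>\<^sub>4 t) (at t)"
    "\<And>t. P t = 0 \<Longrightarrow> \<phi>\<^sub>1 t = 0 \<and> \<phi>\<^sub>2 t = 0 \<and> \<phi>\<^sub>3 t = 0"
    "\<And>t. t \<in> {0..L} \<Longrightarrow> 0 \<le> P t \<and> P t \<le> 1"
    "\<And>t. t \<in> {0..L} \<Longrightarrow> \<bar>\<phi>\<^sub>2 t - \<phi>\<^sub>1 t\<bar> \<le> 80 * \<epsilon> * P t ^ 6"
    "\<And>t. t \<in> {0..L} \<Longrightarrow> \<bar>\<phi>\<^sub>4 t - \<phi>\<^sub>3 t\<bar> \<le> 7056 * \<epsilon> * P t ^ 4"
proof -
  define S where "S t = 1 - 2 * \<epsilon> * t" for t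
  define \<phi>\<^sub>1 where "\<phi>\<^sub>1 t = \<epsilon> * (8 * P t ^ 7 * S t)" for t
  define \<phi>\<^sub>2 where "\<phi>\<^sub>2 t = \<epsilon> ^ 2 * (56 * P t ^ 6 * S t ^ 2 - 16 * P t ^ 7)" for t
  define \<phi>\<^sub>3 where "\<phi>\<^sub>3 t = \<epsilon> ^ 3 * (336 * P t ^ 5 * S t ^ 3 - 336 * P t ^ 6 * S t)" for t
  define \<phi>\<^sub>4 where "\<phi>\<^sub>4 t = \<epsilon> ^ 4 * (1680 * P t ^ 4 * S t ^ 4 - 4032 * P t ^ 5 * S t ^ 2 + 672 * P t ^ 6)" for t
  have P': "(P has_real_derivative \<epsilon> * S t) (at t)" for t
    unfolding P_eq[abs_def] S_def by (auto intro!: derivative_eq_intros simp: algebra_simps)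
  have S': "(S has_real_derivative - 2 * \<epsilon>) (at t)" for t
    unfolding S_def by (auto intro!: derivative_eq_intros)
  have PS: "0 \<le> P t \<and> P t \<le> 1 \<and> \<bar>S t\<bar> \<le> 1" if "t \<in> {0..L}" for t
  proof -
    have "0 \<le> \<epsilon> * t" using that \<epsilon> by simp
    moreover have "\<epsilon> * t \<le> 1" using that \<epsilon> mult_left_mono[of t L \<epsilon>] by (simp add: \<epsilon>L)
    ultimately show ?thesis
      by (auto simp: P_eq S_def abs_le_iff intro: mult_le_one)
  qed
  have mono_le: "\<bar>c * P t ^ m * S t ^ j\<bar> \<le> \<bar>c\<bar> * P t ^ n" if "t \<in> {0..L}" "n \<le> m" for c t m n j
  proof -
    have "P t ^ m * \<bar>S t\<bar> ^ j \<le> P t ^ n * 1"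
      using PS[OF that(1)] that(2) by (intro mult_mono power_decreasing power_le_one) auto
    then have "\<bar>c\<bar> * (P t ^ m * \<bar>S t\<bar> ^ j) \<le> \<bar>c\<bar> * P t ^ n" by (simp add: mult_left_mono)
    then show ?thesis using PS[OF that(1)] by (simp add: abs_mult power_abs mult.assoc)
  qed
  have scale: "\<bar>\<epsilon> ^ k * v\<bar> \<le> \<epsilon> * B" if "\<bar>v\<bar> \<le> B" "1 \<le> k" for k v B
  proof -
    have "\<epsilon> ^ k \<le> \<epsilon> ^ 1" using \<epsilon> that by (intro power_decreasing) auto
    then have "\<epsilon> ^ k * \<bar>v\<bar> \<le> \<epsilon> * B" using \<epsilon> that by (intro mult_mono) auto
    then show ?thesis using \<epsilon> by (simp add: abs_mult)
  qed
  show thesis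
  proof (rule that)
    fix t
    show "((\<lambda>t. P t ^ 8) has_real_derivative \<phi>\<^sub>1 t) (at t)"
      by (rule derivative_eq_intros P' refl)+ (simp add: \<phi>\<^sub>1_def)
    show "(\<phi>\<^sub>1 has_real_derivative \<phi>\<^sub>2 t) (at t)" unfolding \<phi>\<^sub>1_def
      by (rule derivative_eq_intros P' S' refl)+ (simp add: \<phi>\<^sub>2_def algebra_simps eval_nat_numeral)
    show "(\<phi>\<^sub>2 has_real_derivative \<phi>\<^sub>3 t) (at t)" unfolding \<phi>\<^sub>2_def
      by (rule derivative_eq_intros P' S' refl)+ (simp add: \<phi>\<^sub>3_def algebra_simps eval_nat_numeral)
    show "(\<phi>\<^sub>3 has_real_derivative \<phi>\<^sub>4 t) (at t)" unfolding \<phi>\<^sub>3_def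
      by (rule derivative_eq_intros P' S' refl)+ (simp add: \<phi>\<^sub>4_def algebra_simps eval_nat_numeral)
    show "\<phi>\<^sub>1 t = 0 \<and> \<phi>\<^sub>2 t = 0 \<and> \<phi>\<^sub>3 t = 0" if "P t = 0"
      using that by (simp add: \<phi>\<^sub>1_def \<phi>\<^sub>2_def \<phi>\<^sub>3_def)
  next
    fix t assume t: "t \<in> {0..L}"
    show "0 \<le> P t \<and> P t \<le> 1" using PS[OF t] by blast
    have "\<bar>\<phi>\<^sub>1 t\<bar> \<le> \<epsilon> * (8 * P t ^ 6)"
      unfolding \<phi>\<^sub>1_def using scale[of "8 * P t ^ 7 * S t" "8 * P t ^ 6" 1] mono_le[OF t, of 6 7 8 1] by simp
    moreover have "\<bar>\<phi>\<^sub>2 t\<bar> \<le> \<epsilon> * (72 * P t ^ 6)"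
      unfolding \<phi>\<^sub>2_def
    proof (rule scale)
      have "\<bar>56 * P t ^ 6 * S t ^ 2\<bar> \<le> 56 * P t ^ 6" "\<bar>16 * P t ^ 7\<bar> \<le> 16 * P t ^ 6"
        using mono_le[OF t, of 6 6 56 2] mono_le[OF t, of 6 7 16 0] by simp_all
      then show "\<bar>56 * P t ^ 6 * S t ^ 2 - 16 * P t ^ 7\<bar> \<le> 72 * P t ^ 6" by linarith
    qed simp
    ultimately show "\<bar>\<phi>\<^sub>2 t - \<phi>\<^sub>1 t\<bar> \<le> 80 * \<epsilon> * P t ^ 6" by linarith
    have "\<bar>\<phi>\<^sub>3 t\<bar> \<le> \<epsilon> * (672 * P t ^ 4)"
      unfolding \<phi>\<^sub>3_def
    proof (rule scale)
      have "\<bar>336 * P t ^ 5 * S t ^ 3\<bar> \<le> 336 * P t ^ 4" "\<bar>336 * P t ^ 6 * S t\<bar> \<le> 336 * P t ^ 4"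
        using mono_le[OF t, of 4 5 336 3] mono_le[OF t, of 4 6 336 1] by simp_all
      then show "\<bar>336 * P t ^ 5 * S t ^ 3 - 336 * P t ^ 6 * S t\<bar> \<le> 672 * P t ^ 4" by linarith
    qed simp
    moreover have "\<bar>\<phi>\<^sub>4 t\<bar> \<le> \<epsilon> * (6384 * P t ^ 4)"
      unfolding \<phi>\<^sub>4_def
    proof (rule scale)
      have "\<bar>1680 * P t ^ 4 * S t ^ 4\<bar> \<le> 1680 * P t ^ 4" "\<bar>4032 * P t ^ 5 * S t ^ 2\<bar> \<le> 4032 * P t ^ 4"
        "\<bar>672 * P t ^ 6\<bar> \<le> 672 * P t ^ 4"
        using mono_le[OF t, of 4 4 1680 4] mono_le[OF t, of 4 5 4032 2] mono_le[OF t, of 4 6 672 0]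
        by simp_all
      then show "\<bar>1680 * P t ^ 4 * S t ^ 4 - 4032 * P t ^ 5 * S t ^ 2 + 672 * P t ^ 6\<bar> \<le> 6384 * P t ^ 4"
        by linarith
    qed simp
    ultimately show "\<bar>\<phi>\<^sub>4 t - \<phi>\<^sub>3 t\<bar> \<le> 7056 * \<epsilon> * P t ^ 4" by linarith
  qed
qed

text \<open>Two uses of the inequality between arithmetic and geometric means: the first trades the mixed term
for \<open>s\<^sup>2 P\<^sup>8\<close> and a multiple of \<open>\<epsilon> v\<^sup>2 P\<^sup>4\<close>, the second absorbs all terms
\<open>\<epsilon> v\<^sup>2 P\<^sup>4\<close> into \<open>m v\<^sup>4 P\<^sup>8\<close>. What remains is of order \<open>\<epsilon>\<^sup>2\<close>, which is the gain over the
length \<open>1 / \<epsilon>\<close> of the interval.\<close>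

lemma absorb_lower_order_terms:
  fixes \<epsilon> \<kappa> m v s P A B :: real
  assumes \<epsilon>: "0 < \<epsilon>" "\<epsilon> \<le> 1" and "\<kappa> \<ge> 0" "m > 0" and P: "0 \<le> P" "P \<le> 1"
    and A: "\<bar>A\<bar> \<le> 80 * \<epsilon> * P ^ 6" and B: "\<bar>B\<bar> \<le> 7056 * \<epsilon> * P ^ 4"
  shows "2 * v * s * A + \<kappa> / 2 * v ^ 2 * A + v ^ 2 / 2 * B
    \<le> (s ^ 2 + m * v ^ 4) * P ^ 8 + \<epsilon> ^ 2 * ((9928 + 40 * \<kappa>) ^ 2 / (4 * m))"
proof -
  define y where "y = v ^ 2 * P ^ 4"
  define K where "K = 9928 + 40 * \<kappa>"
  have y0: "y \<ge> 0" unfolding y_def by simp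
  \<comment> \<open>The constant \<open>9928 = 80\<^sup>2 + 7056 / 2\<close> collects the contributions of the mixed term and of
    \<open>B\<close>.\<close>
  have "2 * v * s * A \<le> 2 * \<bar>v\<bar> * \<bar>s\<bar> * \<bar>A\<bar>"
    using abs_ge_self[of "2 * v * s * A"] by (simp add: abs_mult)
  also have "\<dots> \<le> 2 * \<bar>v\<bar> * \<bar>s\<bar> * (80 * \<epsilon> * P ^ 6)" by (intro mult_left_mono A) auto
  also have "\<dots> = 2 * (\<bar>s\<bar> * P ^ 4) * (80 * \<epsilon> * \<bar>v\<bar> * P ^ 2)" by (simp add: eval_nat_numeral)
  also have "\<dots> \<le> (\<bar>s\<bar> * P ^ 4) ^ 2 + (80 * \<epsilon> * \<bar>v\<bar> * P ^ 2) ^ 2" by (rule sum_squares_bound)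
  also have "\<dots> = s ^ 2 * P ^ 8 + 6400 * \<epsilon> ^ 2 * y"
    by (simp add: y_def power_mult_distrib power_mult[symmetric])
  also have "6400 * \<epsilon> ^ 2 * y \<le> 6400 * \<epsilon> * y"
    using \<epsilon> y0 by (intro mult_right_mono) (auto simp: power2_eq_square)
  finally have 1: "2 * v * s * A \<le> s ^ 2 * P ^ 8 + 6400 * \<epsilon> * y" by simp
  have "\<kappa> / 2 * v ^ 2 * A \<le> \<kappa> / 2 * v ^ 2 * (80 * \<epsilon> * P ^ 4)"
  proof (intro mult_left_mono)
    have "80 * \<epsilon> * P ^ 6 \<le> 80 * \<epsilon> * P ^ 4"
      using \<epsilon> P by (intro mult_left_mono power_decreasing) auto
    then show "A \<le> 80 * \<epsilon> * P ^ 4" using A by linarith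
  qed (use \<open>\<kappa> \<ge> 0\<close> in auto)
  then have 2: "\<kappa> / 2 * v ^ 2 * A \<le> 40 * \<kappa> * \<epsilon> * y" by (simp add: y_def algebra_simps)
  have "v ^ 2 / 2 * B \<le> v ^ 2 / 2 * (7056 * \<epsilon> * P ^ 4)"
    using B by (intro mult_left_mono) auto
  then have 3: "v ^ 2 / 2 * B \<le> 3528 * \<epsilon> * y" by (simp add: y_def algebra_simps)
  have "4 * m * (m * y ^ 2 + \<epsilon> ^ 2 * (K ^ 2 / (4 * m))) = (2 * m * y) ^ 2 + (\<epsilon> * K) ^ 2"
    using \<open>m > 0\<close> by (simp add: field_simps power2_eq_square)
  then have "4 * m * (\<epsilon> * K * y) \<le> 4 * m * (m * y ^ 2 + \<epsilon> ^ 2 * (K ^ 2 / (4 * m)))"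
    using sum_squares_bound[of "2 * m * y" "\<epsilon> * K"] by (simp add: mult_ac)
  then have "\<epsilon> * K * y \<le> m * y ^ 2 + \<epsilon> ^ 2 * (K ^ 2 / (4 * m))" using \<open>m > 0\<close> by simp
  moreover have "m * y ^ 2 = m * v ^ 4 * P ^ 8"
    by (simp add: y_def power_mult_distrib power_mult[symmetric])
  moreover have "\<epsilon> * K * y = 9928 * \<epsilon> * y + 40 * \<kappa> * \<epsilon> * y" by (simp add: K_def algebra_simps)
  ultimately show ?thesis using 1 2 3 unfolding K_def[symmetric] by (simp add: algebra_simps)
qed

text \<open>Testing over \<open>[0, L]\<close>, the monotone quantity \<open>G \<ge> g\<close> contributes a multiple of
\<open>g L\<close>, while all terms of indefinite sign contribute at most a multiple of \<open>1 / L\<close>, and the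
boundary terms vanish. So a positive initial value \<open>g\<close> of \<open>G\<close> excludes solutions on long
intervals.\<close>

lemma lifespan_bound:
  fixes \<gamma> \<kappa> D g L :: real and f w p z q :: "real \<Rightarrow> real"
  assumes \<gamma>: "\<gamma> > 0" and \<kappa>: "\<kappa> \<ge> 0" and D: "D > 0" and f: "\<And>s. D * s ^ 4 \<le> s * f s"
    and L: "L \<ge> 1"
    and w: "\<And>t. t \<in> {0..L} \<Longrightarrow> (w has_real_derivative p t) (at t)"
    and p: "\<And>t. t \<in> {0..L} \<Longrightarrow> (p has_real_derivative - (\<gamma> * z t)) (at t)"
    and z: "\<And>t. t \<in> {0..L} \<Longrightarrow> (z has_real_derivative q t) (at t)"
    and q: "\<And>t. t \<in> {0..L} \<Longrightarrow> (q has_real_derivative 2 * f (w t) + \<kappa> * z t) (at t)"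
    and init: "\<gamma> * (w 0 * q 0 - p 0 * z 0) + \<kappa> * w 0 * p 0 = g" "g > 0"
  shows "L ^ 2 \<le> 6 ^ 8 * ((9928 + 40 * \<kappa>) ^ 2 / (4 * (2 * \<gamma> * D))) / g"
proof -
  define C where "C = (9928 + 40 * \<kappa>) ^ 2 / (4 * (2 * \<gamma> * D))"
  define \<epsilon> where "\<epsilon> = 1 / L"
  have \<epsilon>: "0 < \<epsilon>" "\<epsilon> \<le> 1" and \<epsilon>L: "\<epsilon> * L = 1" using L by (auto simp: \<epsilon>_def)
  define P where "P t = \<epsilon> * t * (1 - \<epsilon> * t)" for t
  obtain \<phi>\<^sub>1 \<phi>\<^sub>2 \<phi>\<^sub>3 \<phi>\<^sub>4 where \<phi>:
    "\<And>t. ((\<lambda>t. P t ^ 8) has_real_derivative \<phi>\<^sub>1 t) (at t)"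
    "\<And>t. (\<phi>\<^sub>1 has_real_derivative \<phi>\<^sub>2 t) (at t)"
    "\<And>t. (\<phi>\<^sub>2 has_real_derivative \<phi>\<^sub>3 t) (at t)"
    "\<And>t. (\<phi>\<^sub>3 has_real_derivative \<phi>\<^sub>4 t) (at t)"
    and \<phi>_zero: "\<And>t. P t = 0 \<Longrightarrow> \<phi>\<^sub>1 t = 0 \<and> \<phi>\<^sub>2 t = 0 \<and> \<phi>\<^sub>3 t = 0"
    and P: "\<And>t. t \<in> {0..L} \<Longrightarrow> 0 \<le> P t \<and> P t \<le> 1"
    and A: "\<And>t. t \<in> {0..L} \<Longrightarrow> \<bar>\<phi>\<^sub>2 t - \<phi>\<^sub>1 t\<bar> \<le> 80 * \<epsilon> * P t ^ 6"
    and B: "\<And>t. t \<in> {0..L} \<Longrightarrow> \<bar>\<phi>\<^sub>4 t - \<phi>\<^sub>3 t\<bar> \<le> 7056 * \<epsilon> * P t ^ 4"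
    by (rule bump_function[OF \<epsilon> \<epsilon>L P_def]) (rule that, assumption+)
  define G where "G t = \<gamma> * (w t * q t - p t * z t) + \<kappa> * w t * p t" for t
  define \<Psi> where "\<Psi> t = p t ^ 2 + \<gamma> * w t * z t + \<kappa> / 2 * w t ^ 2" for t
  define Q where "Q t = G t * P t ^ 8 + \<Psi> t * (P t ^ 8 - \<phi>\<^sub>1 t) + w t * p t * (\<phi>\<^sub>2 t - \<phi>\<^sub>1 t)
           - w t ^ 2 / 2 * (\<phi>\<^sub>3 t - \<phi>\<^sub>2 t)" for t
  define N where "N t = (\<gamma> * z t) ^ 2 + \<kappa> * p t ^ 2 + 2 * \<gamma> * (w t * f (w t))" for t
  have G': "(G has_real_derivative N t) (at t)"
    and Q': "(Q has_real_derivative (N t + G t) * P t ^ 8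
          - 2 * w t * (\<gamma> * z t) * (\<phi>\<^sub>2 t - \<phi>\<^sub>1 t) - \<kappa> / 2 * w t ^ 2 * (\<phi>\<^sub>2 t - \<phi>\<^sub>1 t)
          - w t ^ 2 / 2 * (\<phi>\<^sub>4 t - \<phi>\<^sub>3 t)) (at t)" if t: "t \<in> {0..L}" for t
    using virial_identity[where t=t and w=w and p=p and z=z and q=q and f=f and \<gamma>=\<gamma> and \<kappa>=\<kappa>
        and \<phi>\<^sub>0="\<lambda>t. P t ^ 8" and \<phi>\<^sub>1=\<phi>\<^sub>1 and \<phi>\<^sub>2=\<phi>\<^sub>2 and \<phi>\<^sub>3=\<phi>\<^sub>3 and \<phi>\<^sub>4="\<phi>\<^sub>4 t",
        OF w[OF t] p[OF t] z[OF t] q[OF t] \<phi>]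
    unfolding G_def[abs_def] N_def Q_def[abs_def] \<Psi>_def by simp_all
  have N_ge: "(\<gamma> * z t) ^ 2 + 2 * \<gamma> * D * w t ^ 4 \<le> N t" for t
  proof -
    have "2 * \<gamma> * (D * w t ^ 4) \<le> 2 * \<gamma> * (w t * f (w t))"
      using f[of "w t"] \<gamma> by (intro mult_left_mono) auto
    moreover have "0 \<le> \<kappa> * p t ^ 2" using \<kappa> by simp
    ultimately show ?thesis unfolding N_def by (simp add: mult.assoc)
  qed
  have G_ge: "g \<le> G t" if t: "t \<in> {0..L}" for t
  proof -
    have "G 0 \<le> G t"
    proof (rule DERIV_nonneg_imp_nondecreasing[of 0 t G])
      fix r assume r: "0 \<le> r" "r \<le> t"
      have "0 \<le> (\<gamma> * z r) ^ 2 + 2 * \<gamma> * D * w r ^ 4" using \<gamma> D by simp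
      then have "0 \<le> N r" using N_ge[of r] by linarith
      then show "\<exists>y. DERIV G r :> y \<and> 0 \<le> y" using G'[of r] r t by auto
    qed (use t in simp)
    then show ?thesis using init(1) by (simp add: G_def)
  qed
  define c where "c = g / 6 ^ 8"
  \<comment> \<open>By Bernoulli's inequality \<open>(6 P)\<^sup>8 \<ge> 48 P - 7\<close>, the tangent at the mean value \<open>1 / 6\<close> of
    \<open>P\<close>, and the integral of the right-hand side over \<open>[0, L]\<close> is exactly \<open>L\<close>. The polynomial
    subtracted from \<open>Q\<close> is an antiderivative of the resulting lower bound for \<open>Q'\<close>, so \<open>H\<close> is nondecreasing.\<close>
  define H where "H t = Q t - (c * (24 * \<epsilon> * t ^ 2 - 16 * \<epsilon> ^ 2 * t ^ 3 - 7 * t) - \<epsilon> ^ 2 * C * t)" for t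
  have "H 0 \<le> H L"
  proof (rule DERIV_nonneg_imp_nondecreasing[of 0 L H])
    fix t assume "0 \<le> t" "t \<le> L"
    then have t: "t \<in> {0..L}" by simp
    define Q1 where "Q1 = (N t + G t) * P t ^ 8
          - 2 * w t * (\<gamma> * z t) * (\<phi>\<^sub>2 t - \<phi>\<^sub>1 t) - \<kappa> / 2 * w t ^ 2 * (\<phi>\<^sub>2 t - \<phi>\<^sub>1 t)
          - w t ^ 2 / 2 * (\<phi>\<^sub>4 t - \<phi>\<^sub>3 t)"
    have "(H has_real_derivative Q1 - (c * (48 * P t - 7) - \<epsilon> ^ 2 * C)) (at t)"
      unfolding H_def
      by (rule derivative_eq_intros Q'[OF t, folded Q1_def] refl)+
         (simp add: P_def algebra_simps power2_eq_square)
    moreover have "c * (48 * P t - 7) - \<epsilon> ^ 2 * C \<le> Q1"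
    proof -
      have "1 + real 8 * (6 * P t - 1) \<le> (1 + (6 * P t - 1)) ^ 8"
        using P[OF t] by (intro Bernoulli_inequality) auto
      then have "c * (48 * P t - 7) \<le> c * (6 ^ 8 * P t ^ 8)"
        using init(2) by (intro mult_left_mono) (auto simp: c_def power_mult_distrib)
      also have "\<dots> = g * P t ^ 8" by (simp add: c_def)
      also have "\<dots> \<le> G t * P t ^ 8" using G_ge[OF t] P[OF t] by (intro mult_right_mono) auto
      finally have 1: "c * (48 * P t - 7) \<le> G t * P t ^ 8" .
      have 2: "((\<gamma> * z t) ^ 2 + 2 * \<gamma> * D * w t ^ 4) * P t ^ 8 \<le> N t * P t ^ 8"
        using N_ge by (intro mult_right_mono) auto
      have "0 < 2 * \<gamma> * D" using \<gamma> D by simp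
      from absorb_lower_order_terms[OF \<epsilon> \<kappa> this _ _ A[OF t] B[OF t], of "w t" "\<gamma> * z t"] P[OF t]
      have 3: "2 * w t * (\<gamma> * z t) * (\<phi>\<^sub>2 t - \<phi>\<^sub>1 t) + \<kappa> / 2 * w t ^ 2 * (\<phi>\<^sub>2 t - \<phi>\<^sub>1 t)
          + w t ^ 2 / 2 * (\<phi>\<^sub>4 t - \<phi>\<^sub>3 t)
          \<le> ((\<gamma> * z t) ^ 2 + 2 * \<gamma> * D * w t ^ 4) * P t ^ 8 + \<epsilon> ^ 2 * C"
        unfolding C_def by blast
      have "(N t + G t) * P t ^ 8 = N t * P t ^ 8 + G t * P t ^ 8" by (rule distrib_right)
      then show ?thesis unfolding Q1_def using 1 2 3 by linarith
    qed
    ultimately show "\<exists>y. DERIV H t :> y \<and> 0 \<le> y" by force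
  qed (use L in simp)
  moreover have "P 0 = 0" "P L = 0" using \<epsilon>L by (auto simp: P_def)
  then have "Q 0 = 0" "Q L = 0" using \<phi>_zero[of 0] \<phi>_zero[of L] by (auto simp: Q_def)
  moreover have "24 * \<epsilon> * L ^ 2 - 16 * \<epsilon> ^ 2 * L ^ 3 - 7 * L = L" "\<epsilon> ^ 2 * C * L = C / L"
    using L by (simp_all add: \<epsilon>_def field_simps eval_nat_numeral)
  ultimately have "c * L \<le> C / L" by (simp add: H_def)
  then have "g * L ^ 2 \<le> 6 ^ 8 * C" using L by (simp add: c_def field_simps power2_eq_square)
  then show ?thesis using init(2) unfolding C_def[symmetric] by (simp add: field_simps)
qed

section \<open>One-sided bounds near a finite time\<close>

definition bdd_below_near :: "(real \<Rightarrow> real) \<Rightarrow> real \<Rightarrow> bool"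
  where "bdd_below_near g R \<longleftrightarrow> (\<exists>K. \<forall>\<^sub>F t in at_left R. K \<le> g t)"

definition deriv_near :: "(real \<Rightarrow> real) \<Rightarrow> (real \<Rightarrow> real) \<Rightarrow> real \<Rightarrow> bool"
  where "deriv_near g g' R \<longleftrightarrow> (\<forall>\<^sub>F t in at_left R. (g has_real_derivative g' t) (at t))"

lemma bdd_below_nearI: "\<forall>\<^sub>F t in at_left R. K \<le> g t \<Longrightarrow> bdd_below_near g R"
  unfolding bdd_below_near_def by blast

lemma deriv_near_uminus:
  "deriv_near g g' R \<Longrightarrow> deriv_near (\<lambda>t. - g t) (\<lambda>t. - g' t) R"
  unfolding deriv_near_def by (erule eventually_mono) (rule DERIV_minus)

lemma bdd_below_near_antideriv:
  assumes "deriv_near g g' R" and "bdd_below_near g' R"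
  shows "bdd_below_near g R"
proof -
  obtain K where K: "\<forall>\<^sub>F t in at_left R. K \<le> g' t"
    using assms unfolding bdd_below_near_def by blast
  have "\<forall>\<^sub>F t in at_left R. (g has_real_derivative g' t) (at t) \<and> K \<le> g' t"
    using assms(1) K unfolding deriv_near_def by (rule eventually_conj)
  then obtain s0 where s0: "s0 < R"
    "\<And>t. s0 < t \<Longrightarrow> t < R \<Longrightarrow> (g has_real_derivative g' t) (at t) \<and> K \<le> g' t"
    by (auto simp: eventually_at_left_field)
  define s where "s = (s0 + R) / 2"
  have s: "s0 < s" "s < R" using s0 by (simp_all add: s_def field_simps)
  have "g s - \<bar>K\<bar> * (R - s) \<le> g t" if t: "s < t" "t < R" for t
  proof -
    have "g s - K * s \<le> g t - K * t"
    proof (rule DERIV_nonneg_imp_nondecreasing[where f = "\<lambda>t. g t - K * t"])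
      fix r assume "s \<le> r" "r \<le> t"
      then have "(g has_real_derivative g' r) (at r)" "K \<le> g' r" using s0(2)[of r] s t by auto
      then show "\<exists>y. ((\<lambda>t. g t - K * t) has_real_derivative y) (at r) \<and> 0 \<le> y"
        by (intro exI[of _ "g' r - K"]) (auto intro!: derivative_eq_intros)
    qed (use t in simp)
    moreover have "- (\<bar>K\<bar> * (R - s)) \<le> K * (t - s)"
    proof -
      have "\<bar>K\<bar> * (t - s) \<le> \<bar>K\<bar> * (R - s)" using t by (intro mult_left_mono) auto
      moreover have "- (\<bar>K\<bar> * (t - s)) \<le> K * (t - s)"
        using mult_right_mono[of "- \<bar>K\<bar>" K "t - s"] t by auto
      ultimately show ?thesis by linarith
    qed
    ultimately show ?thesis by (simp add: algebra_simps)
  qed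
  then show ?thesis unfolding bdd_below_near_def eventually_at_left_field using s(2) by blast
qed

text \<open>Positive solutions of \<open>c'' = \<theta> c\<close>, used below as integrating factors. For \<open>\<theta> < 0\<close> the
solutions oscillate, and positivity is available only close to \<open>R\<close>, here within a sixth of a period.\<close>

lemma positive_linear_solution_near:
  fixes \<theta> R :: real
  obtains c c' :: "real \<Rightarrow> real" and m M :: real where "m > 0"
    "deriv_near c c' R" "deriv_near c' (\<lambda>t. \<theta> * c t) R"
    "\<forall>\<^sub>F t in at_left R. m \<le> c t \<and> c t \<le> M"
proof (cases "\<theta> \<ge> 0")
  case True
  define l where "l = sqrt \<theta>"
  have l: "l \<ge> 0" "l * l = \<theta>" using True by (auto simp: l_def)
  show thesis
  proof (rule that)
    show "exp (l * (R - 1)) > 0" by simp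
    show "deriv_near (\<lambda>t. exp (l * t)) (\<lambda>t. l * exp (l * t)) R"
      "deriv_near (\<lambda>t. l * exp (l * t)) (\<lambda>t. \<theta> * exp (l * t)) R"
      unfolding deriv_near_def l(2)[symmetric]
      by (auto intro!: always_eventually derivative_eq_intros)
    have "\<forall>\<^sub>F t in at_left R. R - 1 < t \<and> t < R"
      unfolding eventually_at_left_field by (intro exI[of _ "R - 1"]) auto
    then show "\<forall>\<^sub>F t in at_left R. exp (l * (R - 1)) \<le> exp (l * t) \<and> exp (l * t) \<le> exp (l * R)"
      by eventually_elim (auto intro!: mult_left_mono l)
  qed
next
  case False
  define l where "l = sqrt (- \<theta>)"
  have l: "l > 0" "l * l = - \<theta>" using False by (auto simp: l_def)
  show thesis
  proof (rule that)
    show "(1/2 :: real) > 0" by simp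
    show "deriv_near (\<lambda>t. cos (l * (R - t))) (\<lambda>t. l * sin (l * (R - t))) R"
      unfolding deriv_near_def by (auto intro!: always_eventually derivative_eq_intros)
    have "((\<lambda>t. l * sin (l * (R - t))) has_real_derivative (\<theta> * cos (l * (R - t)))) (at t)" for t
    proof -
      have "((\<lambda>t. l * sin (l * (R - t))) has_real_derivative (- (l * l) * cos (l * (R - t)))) (at t)"
        by (auto intro!: derivative_eq_intros)
      then show ?thesis using l(2) by simp
    qed
    then show "deriv_near (\<lambda>t. l * sin (l * (R - t))) (\<lambda>t. \<theta> * cos (l * (R - t))) R"
      unfolding deriv_near_def by (simp add: always_eventually)
    have "\<forall>\<^sub>F t in at_left R. R - pi / (3 * l) < t \<and> t < R"
      unfolding eventually_at_left_field using l by (intro exI[of _ "R - pi / (3 * l)"]) auto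
    then show "\<forall>\<^sub>F t in at_left R. 1/2 \<le> cos (l * (R - t)) \<and> cos (l * (R - t)) \<le> 1"
    proof eventually_elim
      case (elim t)
      then have "0 \<le> l * (R - t)" "l * (R - t) \<le> pi / 3" using l by (auto simp: field_simps)
      then have "cos (pi / 3) \<le> cos (l * (R - t))" by (intro cos_monotone_0_pi_le) auto
      then show ?case by (simp add: cos_60)
    qed
  qed
qed

text \<open>With a positive solution \<open>c\<close> of \<open>c'' = \<theta> c\<close>, the Wronskian satisfies
\<open>(w' c - w c')' = (w'' - \<theta> w) c\<close> and \<open>(w / c)' = (w' c - w c') / c\<^sup>2\<close>, so two integrations
over a bounded interval suffice.\<close>

lemma bdd_below_near_second_order:
  assumes w: "deriv_near w w' R" and w': "deriv_near w' w'' R"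
    and ineq: "bdd_below_near (\<lambda>t. w'' t - \<theta> * w t) R"
  shows "bdd_below_near w R"
proof -
  obtain c c' :: "real \<Rightarrow> real" and m M where c: "m > 0"
    "deriv_near c c' R" "deriv_near c' (\<lambda>t. \<theta> * c t) R"
    "\<forall>\<^sub>F t in at_left R. m \<le> c t \<and> c t \<le> M"
    by (rule positive_linear_solution_near)
  obtain K where K: "\<forall>\<^sub>F t in at_left R. K \<le> w'' t - \<theta> * w t"
    using ineq unfolding bdd_below_near_def by blast
  have "deriv_near (\<lambda>t. w' t * c t - w t * c' t) (\<lambda>t. (w'' t - \<theta> * w t) * c t) R"
    using w w' c(2,3) unfolding deriv_near_def
  proof eventually_elim
    case (elim t)
    have "((\<lambda>t. w' t * c t - w t * c' t) has_real_derivative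
        (w'' t * c t + c' t * w' t) - (w' t * c' t + \<theta> * c t * w t)) (at t)"
      by (rule DERIV_diff[OF DERIV_mult[OF elim(2,3)] DERIV_mult[OF elim(1,4)]])
    then show ?case by (simp add: algebra_simps)
  qed
  moreover have "\<forall>\<^sub>F t in at_left R. - (\<bar>K\<bar> * M) \<le> (w'' t - \<theta> * w t) * c t"
    using K c(4)
  proof eventually_elim
    case (elim t)
    have "\<bar>K\<bar> * c t \<le> \<bar>K\<bar> * M" using elim by (intro mult_left_mono) auto
    moreover have "- \<bar>K\<bar> * c t \<le> (w'' t - \<theta> * w t) * c t"
      using elim c(1) by (intro mult_right_mono) auto
    ultimately show ?case by linarith
  qed
  ultimately have "bdd_below_near (\<lambda>t. w' t * c t - w t * c' t) R"
    by (rule bdd_below_near_antideriv[OF _ bdd_below_nearI])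
  then obtain J where J: "\<forall>\<^sub>F t in at_left R. J \<le> w' t * c t - w t * c' t"
    unfolding bdd_below_near_def by blast
  have "deriv_near (\<lambda>t. w t / c t) (\<lambda>t. (w' t * c t - w t * c' t) / (c t * c t)) R"
    using w c(2,4) unfolding deriv_near_def
  proof eventually_elim
    case (elim t)
    have "c t \<noteq> 0" using elim c(1) by linarith
    then show ?case by (rule DERIV_divide[OF elim(1,2)])
  qed
  moreover have "\<forall>\<^sub>F t in at_left R. - (\<bar>J\<bar> / (m * m)) \<le> (w' t * c t - w t * c' t) / (c t * c t)"
    using J c(4)
  proof eventually_elim
    case (elim t)
    have "m * m \<le> c t * c t" using elim c(1) by (intro mult_mono) auto
    moreover have "m * m > 0" using c(1) by simp
    ultimately have "\<bar>J\<bar> / (c t * c t) \<le> \<bar>J\<bar> / (m * m)" by (intro divide_left_mono) auto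
    moreover have "- \<bar>J\<bar> / (c t * c t) \<le> (w' t * c t - w t * c' t) / (c t * c t)"
      using elim by (intro divide_right_mono) auto
    ultimately show ?case unfolding divide_minus_left by linarith
  qed
  ultimately have "bdd_below_near (\<lambda>t. w t / c t) R"
    by (rule bdd_below_near_antideriv[OF _ bdd_below_nearI])
  then obtain I where I: "\<forall>\<^sub>F t in at_left R. I \<le> w t / c t"
    unfolding bdd_below_near_def by blast
  have "\<forall>\<^sub>F t in at_left R. - (\<bar>I\<bar> * M) \<le> w t"
    using I c(4)
  proof eventually_elim
    case (elim t)
    have "- \<bar>I\<bar> \<le> w t / c t" using elim by linarith
    then have "- \<bar>I\<bar> * c t \<le> w t" using elim c(1) by (simp add: pos_le_divide_eq)
    moreover have "\<bar>I\<bar> * c t \<le> \<bar>I\<bar> * M" using elim by (intro mult_left_mono) auto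
    ultimately show ?case by linarith
  qed
  then show ?thesis unfolding bdd_below_near_def by blast
qed

definition bdd_near :: "(real \<Rightarrow> real) \<Rightarrow> real \<Rightarrow> bool"
  where "bdd_near g R \<longleftrightarrow> bdd_below_near g R \<and> bdd_below_near (\<lambda>t. - g t) R"

lemma bdd_near_antideriv:
  "deriv_near g g' R \<Longrightarrow> bdd_near g' R \<Longrightarrow> bdd_near g R"
  unfolding bdd_near_def
  using bdd_below_near_antideriv[of g g' R]
    bdd_below_near_antideriv[of "\<lambda>t. - g t" "\<lambda>t. - g' t" R] deriv_near_uminus by blast

lemma bdd_near_iff: "bdd_near g R \<longleftrightarrow> (\<exists>K. \<forall>\<^sub>F t in at_left R. \<bar>g t\<bar> \<le> K)"
proof
  assume "bdd_near g R"
  then obtain A B where "\<forall>\<^sub>F t in at_left R. A \<le> g t" "\<forall>\<^sub>F t in at_left R. B \<le> - g t"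
    unfolding bdd_near_def bdd_below_near_def by blast
  then have "\<forall>\<^sub>F t in at_left R. \<bar>g t\<bar> \<le> \<bar>A\<bar> + \<bar>B\<bar>" by eventually_elim linarith
  then show "\<exists>K. \<forall>\<^sub>F t in at_left R. \<bar>g t\<bar> \<le> K" by blast
next
  assume "\<exists>K. \<forall>\<^sub>F t in at_left R. \<bar>g t\<bar> \<le> K"
  then obtain K where K: "\<forall>\<^sub>F t in at_left R. \<bar>g t\<bar> \<le> K" by blast
  from K have "\<forall>\<^sub>F t in at_left R. - K \<le> g t" by eventually_elim linarith
  moreover from K have "\<forall>\<^sub>F t in at_left R. - K \<le> - g t" by eventually_elim linarith
  ultimately show "bdd_near g R" unfolding bdd_near_def bdd_below_near_def by blast
qed

text \<open>A solution that blows up at a finite time cannot be bounded on one side: a lower bound for \<open>w\<close>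
bounds \<open>f(w)\<close> below, hence \<open>z\<close> below, hence \<open>w'' = - \<gamma> z\<close> above and so \<open>w\<close> above; then
the forcing \<open>f(w)\<close> is bounded and with it everything else.\<close>

lemma bdd_near_of_bdd_below_near:
  fixes \<gamma> \<kappa> R :: real and f w p z q :: "real \<Rightarrow> real"
  assumes \<gamma>: "\<gamma> > 0" and "\<kappa> \<ge> 0" and f: "mono f"
    and w: "deriv_near w p R" and p: "deriv_near p (\<lambda>t. - (\<gamma> * z t)) R"
    and z: "deriv_near z q R" and q: "deriv_near q (\<lambda>t. 2 * f (w t) + \<kappa> * z t) R"
    and below: "bdd_below_near w R"
  shows "bdd_near w R \<and> bdd_near p R \<and> bdd_near z R \<and> bdd_near q R"
proof -
  obtain K where K: "\<forall>\<^sub>F t in at_left R. K \<le> w t" using below unfolding bdd_below_near_def by blast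
  have "\<forall>\<^sub>F t in at_left R. 2 * f K \<le> (2 * f (w t) + \<kappa> * z t) - \<kappa> * z t"
    using K by eventually_elim (use f in \<open>auto simp: mono_def\<close>)
  then have z_below: "bdd_below_near z R"
    by (rule bdd_below_near_second_order[OF z q bdd_below_nearI])
  then obtain Z where Z: "\<forall>\<^sub>F t in at_left R. Z \<le> z t" unfolding bdd_below_near_def by blast
  have "\<forall>\<^sub>F t in at_left R. \<gamma> * Z \<le> - (- (\<gamma> * z t)) - 0 * - w t"
    using Z by eventually_elim (use \<gamma> in \<open>auto intro!: mult_left_mono\<close>)
  then have w_above: "bdd_below_near (\<lambda>t. - w t) R"
    by (rule bdd_below_near_second_order[OF deriv_near_uminus[OF w] deriv_near_uminus[OF p] bdd_below_nearI])
  then obtain W where W: "\<forall>\<^sub>F t in at_left R. W \<le> - w t" unfolding bdd_below_near_def by blast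
  have "\<forall>\<^sub>F t in at_left R. - (2 * f (- W)) \<le> - (2 * f (w t) + \<kappa> * z t) - \<kappa> * - z t"
    using W
  proof eventually_elim
    case (elim t)
    then have "f (w t) \<le> f (- W)" using f by (auto simp: mono_def)
    then show ?case by simp
  qed
  then have z_above: "bdd_below_near (\<lambda>t. - z t) R"
    by (rule bdd_below_near_second_order[OF deriv_near_uminus[OF z] deriv_near_uminus[OF q] bdd_below_nearI])
  have bw: "bdd_near w R" and bz: "bdd_near z R"
    using below w_above z_below z_above by (auto simp: bdd_near_def)
  obtain M where M: "\<forall>\<^sub>F t in at_left R. \<bar>z t\<bar> \<le> M" using bz bdd_near_iff by blast
  from M have "\<forall>\<^sub>F t in at_left R. \<bar>- (\<gamma> * z t)\<bar> \<le> \<gamma> * M"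
    by eventually_elim (use \<gamma> in \<open>simp add: abs_mult\<close>)
  then have bp: "bdd_near p R" by (intro bdd_near_antideriv[OF p]) (auto simp: bdd_near_iff)
  define A where "A = \<bar>f K\<bar> + \<bar>f (- W)\<bar>"
  have "\<forall>\<^sub>F t in at_left R. \<bar>2 * f (w t) + \<kappa> * z t\<bar> \<le> 2 * A + \<kappa> * M"
    using K W M
  proof eventually_elim
    case (elim t)
    then have "f K \<le> f (w t)" "f (w t) \<le> f (- W)" using f by (auto simp: mono_def)
    then have "f (w t) \<le> A" "- A \<le> f (w t)" unfolding A_def by linarith+
    moreover have "\<kappa> * z t \<le> \<kappa> * M" "\<kappa> * - M \<le> \<kappa> * z t"
      using elim \<open>\<kappa> \<ge> 0\<close> by (intro mult_left_mono; linarith)+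
    then have "\<kappa> * z t \<le> \<kappa> * M" "- (\<kappa> * M) \<le> \<kappa> * z t" by simp_all
    ultimately show ?case by (intro abs_leI; linarith)
  qed
  then have bq: "bdd_near q R" by (intro bdd_near_antideriv[OF q]) (auto simp: bdd_near_iff)
  show ?thesis using bw bp bz bq by blast
qed

text \<open>A lower bound for \<open>z + \<eta> w\<close> or \<open>- z + \<eta> w\<close> is, because \<open>z = - w'' / \<gamma>\<close>, a second-order
differential inequality for \<open>- w\<close> or \<open>w\<close> alone, which gives a one-sided bound for \<open>w\<close>. The
case of \<open>- w\<close> follows from that of \<open>w\<close> by the symmetry
\<open>(w, z, f) \<mapsto> (- w, - z, \<lambda>s. - f (- s))\<close> of the system.\<close>

lemma bdd_near_of_bdd_below_near_combination:
  fixes \<gamma> \<kappa> R \<epsilon> \<eta> :: real and f w p z q :: "real \<Rightarrow> real"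
  assumes \<gamma>: "\<gamma> > 0" and \<kappa>: "\<kappa> \<ge> 0" and f: "mono f"
    and w: "deriv_near w p R" and p: "deriv_near p (\<lambda>t. - (\<gamma> * z t)) R"
    and z: "deriv_near z q R" and q: "deriv_near q (\<lambda>t. 2 * f (w t) + \<kappa> * z t) R"
    and \<epsilon>: "\<bar>\<epsilon>\<bar> = 1" and below: "bdd_below_near (\<lambda>t. \<epsilon> * z t + \<eta> * w t) R"
  shows "bdd_near w R \<and> bdd_near p R \<and> bdd_near z R \<and> bdd_near q R"
proof -
  obtain K where K: "\<forall>\<^sub>F t in at_left R. K \<le> \<epsilon> * z t + \<eta> * w t"
    using below unfolding bdd_below_near_def by blast
  consider "\<epsilon> = -1" | "\<epsilon> = 1" using \<epsilon> by linarith
  then show ?thesis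
  proof cases
    case 1
    have "\<forall>\<^sub>F t in at_left R. \<gamma> * K \<le> - (\<gamma> * z t) - (- \<gamma> * \<eta>) * w t"
      using K
    proof eventually_elim
      case (elim t)
      have "\<gamma> * K \<le> \<gamma> * (\<epsilon> * z t + \<eta> * w t)" using elim \<gamma> by (intro mult_left_mono) auto
      then show ?case using 1 by (simp add: algebra_simps)
    qed
    then have "bdd_below_near w R"
      by (rule bdd_below_near_second_order[OF w p bdd_below_nearI])
    then show ?thesis using bdd_near_of_bdd_below_near[OF \<gamma> \<kappa> f w p z q] by blast
  next
    case 2
    note nw = deriv_near_uminus[OF w] and nz = deriv_near_uminus[OF z]
    have np: "deriv_near (\<lambda>t. - p t) (\<lambda>t. - (\<gamma> * - z t)) R"
      using deriv_near_uminus[OF p] by simp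
    have nq: "deriv_near (\<lambda>t. - q t) (\<lambda>t. 2 * - f (- (- w t)) + \<kappa> * - z t) R"
      using deriv_near_uminus[OF q] by simp
    have "\<forall>\<^sub>F t in at_left R. \<gamma> * K \<le> - (\<gamma> * - z t) - (\<gamma> * \<eta>) * - w t"
      using K
    proof eventually_elim
      case (elim t)
      have "\<gamma> * K \<le> \<gamma> * (\<epsilon> * z t + \<eta> * w t)" using elim \<gamma> by (intro mult_left_mono) auto
      then show ?case using 2 by (simp add: algebra_simps)
    qed
    then have "bdd_below_near (\<lambda>t. - w t) R"
      by (rule bdd_below_near_second_order[OF nw np bdd_below_nearI])
    moreover have "mono (\<lambda>s. - f (- s))" using f by (auto simp: mono_def)
    ultimately have "bdd_near (\<lambda>t. - w t) R \<and> bdd_near (\<lambda>t. - p t) R \<and> bdd_near (\<lambda>t. - z t) R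
        \<and> bdd_near (\<lambda>t. - q t) R"
      using bdd_near_of_bdd_below_near[OF \<gamma> \<kappa> _ nw np nz nq] by blast
    then show ?thesis by (simp add: bdd_near_iff)
  qed
qed

lemma Limsup_at_left_eq_infinity:
  assumes "\<not> bdd_below_near (\<lambda>t. - g t) R"
  shows "Limsup (at_left R) (\<lambda>t. ereal (g t)) = \<infinity>"
proof (rule ccontr)
  assume "Limsup (at_left R) (\<lambda>t. ereal (g t)) \<noteq> \<infinity>"
  then have "Limsup (at_left R) (\<lambda>t. ereal (g t)) < \<infinity>" by simp
  then obtain M where "Limsup (at_left R) (\<lambda>t. ereal (g t)) < ereal M"
    using ereal_dense2 by blast
  then have "\<forall>\<^sub>F t in at_left R. ereal (g t) < ereal M" by (rule Limsup_lessD)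
  then have "\<forall>\<^sub>F t in at_left R. - M \<le> - g t" by eventually_elim simp
  then show False using assms unfolding bdd_below_near_def by blast
qed

lemma Liminf_at_left_eq_minus_infinity:
  assumes "\<not> bdd_below_near g R"
  shows "Liminf (at_left R) (\<lambda>t. ereal (g t)) = -\<infinity>"
proof (rule ccontr)
  assume "Liminf (at_left R) (\<lambda>t. ereal (g t)) \<noteq> -\<infinity>"
  then have "-\<infinity> < Liminf (at_left R) (\<lambda>t. ereal (g t))" by simp
  then obtain M where "ereal M < Liminf (at_left R) (\<lambda>t. ereal (g t))"
    using ereal_dense2 by blast
  then have "\<forall>\<^sub>F t in at_left R. ereal M < ereal (g t)" by (rule less_LiminfD)
  then have "\<forall>\<^sub>F t in at_left R. M \<le> g t" by eventually_elim simp
  then show False using assms unfolding bdd_below_near_def by blast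
qed

section \<open>The cubic nonlinearity\<close>

lemma cubic_lipschitz_on_balls:
  fixes \<sigma> c d :: real
  shows "lipschitz_on_balls (\<lambda>s. \<sigma> * s + c * s ^ 2 + d * s ^ 3)"
proof (rule lipschitz_on_ballsI)
  fix M :: real
  define L where "L = \<bar>\<sigma>\<bar> + \<bar>c\<bar> * (2 * \<bar>M\<bar>) + \<bar>d\<bar> * (3 * \<bar>M\<bar> ^ 2)"
  have "L-lipschitz_on (cball 0 M) (\<lambda>s. \<sigma> * s + c * s ^ 2 + d * s ^ 3)"
  proof (rule lipschitz_onI)
    show "L \<ge> 0" by (simp add: L_def)
    fix s r :: real assume "s \<in> cball 0 M" "r \<in> cball 0 M"
    then have sr: "\<bar>s\<bar> \<le> \<bar>M\<bar>" "\<bar>r\<bar> \<le> \<bar>M\<bar>" by auto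
    have 1: "\<bar>s + r\<bar> \<le> 2 * \<bar>M\<bar>" using sr by linarith
    have "\<bar>s * s\<bar> \<le> \<bar>M\<bar> * \<bar>M\<bar>" "\<bar>s * r\<bar> \<le> \<bar>M\<bar> * \<bar>M\<bar>" "\<bar>r * r\<bar> \<le> \<bar>M\<bar> * \<bar>M\<bar>"
      unfolding abs_mult using sr by (intro mult_mono; simp)+
    then have 2: "\<bar>s * s + s * r + r * r\<bar> \<le> 3 * \<bar>M\<bar> ^ 2"
      unfolding power2_eq_square by linarith
    have "\<bar>\<sigma> + c * (s + r) + d * (s * s + s * r + r * r)\<bar>
        \<le> \<bar>\<sigma>\<bar> + \<bar>c * (s + r)\<bar> + \<bar>d * (s * s + s * r + r * r)\<bar>" by linarith
    also have "\<dots> \<le> L" unfolding L_def abs_mult by (intro add_mono mult_left_mono 1 2) auto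
    finally have "\<bar>s - r\<bar> * \<bar>\<sigma> + c * (s + r) + d * (s * s + s * r + r * r)\<bar> \<le> \<bar>s - r\<bar> * L"
      by (intro mult_left_mono) auto
    moreover have "\<sigma> * s + c * s ^ 2 + d * s ^ 3 - (\<sigma> * r + c * r ^ 2 + d * r ^ 3)
        = (s - r) * (\<sigma> + c * (s + r) + d * (s * s + s * r + r * r))"
      by (simp add: algebra_simps power2_eq_square power3_eq_cube)
    ultimately show "dist (\<sigma> * s + c * s ^ 2 + d * s ^ 3) (\<sigma> * r + c * r ^ 2 + d * r ^ 3) \<le> L * dist s r"
      by (simp add: dist_real_def abs_mult mult.commute)
  qed
  then show "\<exists>L. L-lipschitz_on (cball 0 M) (\<lambda>s. \<sigma> * s + c * s ^ 2 + d * s ^ 3)" by blast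
qed

text \<open>The condition \<open>c\<^sup>2 \<le> 2 d \<sigma>\<close> leaves half of the quartic term over after completing the square.\<close>

lemma cubic_coercive:
  fixes \<sigma> c d s :: real
  assumes "d > 0" and "c ^ 2 \<le> 2 * d * \<sigma>"
  shows "d / 2 * s ^ 4 \<le> s * (\<sigma> * s + c * s ^ 2 + d * s ^ 3)"
proof -
  have "0 \<le> s ^ 2 * ((c + d * s) ^ 2 + (2 * d * \<sigma> - c ^ 2))" using assms by simp
  also have "\<dots> = 2 * d * (s * (\<sigma> * s + c * s ^ 2 + d * s ^ 3) - d / 2 * s ^ 4)"
    by (simp add: algebra_simps eval_nat_numeral)
  finally show ?thesis using assms(1) by (simp add: zero_le_mult_iff)
qed

lemma cubic_mono:
  fixes \<sigma> c d :: real
  assumes "d > 0" and "c ^ 2 \<le> 2 * d * \<sigma>"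
  shows "mono (\<lambda>s. \<sigma> * s + c * s ^ 2 + d * s ^ 3)"
proof (rule monoI)
  fix a b :: real assume "a \<le> b"
  then show "\<sigma> * a + c * a ^ 2 + d * a ^ 3 \<le> \<sigma> * b + c * b ^ 2 + d * b ^ 3"
  proof (rule DERIV_nonneg_imp_nondecreasing[where f = "\<lambda>s. \<sigma> * s + c * s ^ 2 + d * s ^ 3"])
    fix s :: real
    have "0 \<le> (c + 2 * d * s) ^ 2 + 2 * (d * s) ^ 2 + (2 * d * \<sigma> - c ^ 2)" using assms by simp
    also have "\<dots> = 2 * d * (\<sigma> + 2 * c * s + 3 * d * s ^ 2)"
      by (simp add: algebra_simps eval_nat_numeral)
    finally have "0 \<le> \<sigma> + 2 * c * s + 3 * d * s ^ 2" using assms(1) by (simp add: zero_le_mult_iff)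
    moreover have "((\<lambda>s. \<sigma> * s + c * s ^ 2 + d * s ^ 3) has_real_derivative
        \<sigma> + 2 * c * s + 3 * d * s ^ 2) (at s)"
      by (auto intro!: derivative_eq_intros)
    ultimately show "\<exists>D. ((\<lambda>s. \<sigma> * s + c * s ^ 2 + d * s ^ 3) has_real_derivative D) (at s) \<and> 0 \<le> D"
      by blast
  qed
qed

section \<open>The system as a flow in phase space\<close>

definition phase_field :: "(real \<Rightarrow> real) \<Rightarrow> real \<Rightarrow> real \<Rightarrow>
    real \<times> real \<times> real \<times> real \<Rightarrow> real \<times> real \<times> real \<times> real"
  where "phase_field f \<beta> \<delta> = (\<lambda>(x, p, y, q).
    (p, f (y - x) - \<beta> * (y + x), q, f (y - x) - \<delta> * (y + x)))"

lemma phase_field_lipschitz_on_balls: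
  assumes "lipschitz_on_balls f"
  shows "lipschitz_on_balls (phase_field f \<beta> \<delta>)"
proof -
  have fst3: "bounded_linear (\<lambda>u::real \<times> real \<times> real \<times> real. fst (snd (snd u)))"
    and snd3: "bounded_linear (\<lambda>u::real \<times> real \<times> real \<times> real. snd (snd (snd u)))"
    and fst2: "bounded_linear (\<lambda>u::real \<times> real \<times> real \<times> real. fst (snd u))"
    by (intro bounded_linear_fst_comp bounded_linear_snd_comp bounded_linear_snd)+
  have "bounded_linear (\<lambda>u::real \<times> real \<times> real \<times> real. fst (snd (snd u)) - fst u)"
    by (intro bounded_linear_sub fst3 bounded_linear_fst)
  moreover have "bounded_linear (\<lambda>u::real \<times> real \<times> real \<times> real. k * (fst (snd (snd u)) + fst u))" for k
    by (intro bounded_linear_const_mult bounded_linear_add fst3 bounded_linear_fst)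
  ultimately have "lipschitz_on_balls (\<lambda>u::real \<times> real \<times> real \<times> real.
      (fst (snd u), f (fst (snd (snd u)) - fst u) - \<beta> * (fst (snd (snd u)) + fst u),
       snd (snd (snd u)), f (fst (snd (snd u)) - fst u) - \<delta> * (fst (snd (snd u)) + fst u)))"
    by (intro lipschitz_on_balls_Pair lipschitz_on_balls_diff
        lipschitz_on_balls_linear fst2 snd3 lipschitz_on_balls_compose_linear[OF assms])
  then show ?thesis by (simp add: phase_field_def case_prod_beta')
qed

lemma integral_curve_phase_field_iff:
  assumes "open S"
  shows "integral_curve (phase_field f \<beta> \<delta>) S (\<lambda>t. (x t, p t, y t, q t)) \<longleftrightarrow>
    (\<forall>t\<in>S. (x has_real_derivative p t) (at t) \<and>
       (p has_real_derivative f (y t - x t) - \<beta> * (y t + x t)) (at t) \<and>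
       (y has_real_derivative q t) (at t) \<and>
       (q has_real_derivative f (y t - x t) - \<delta> * (y t + x t)) (at t))"
proof -
  have "((\<lambda>t. (x t, p t, y t, q t)) has_vector_derivative (x', p', y', q')) (at t) \<longleftrightarrow>
      (x has_real_derivative x') (at t) \<and> (p has_real_derivative p') (at t) \<and>
      (y has_real_derivative y') (at t) \<and> (q has_real_derivative q') (at t)" for t x' p' y' q'
  proof
    assume u: "((\<lambda>t. (x t, p t, y t, q t)) has_vector_derivative (x', p', y', q')) (at t)"
    note f = bounded_linear.has_vector_derivative[OF bounded_linear_fst]
      and s = bounded_linear.has_vector_derivative[OF bounded_linear_snd]
    show "(x has_real_derivative x') (at t) \<and> (p has_real_derivative p') (at t) \<and>
      (y has_real_derivative y') (at t) \<and> (q has_real_derivative q') (at t)"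
      unfolding has_real_derivative_iff_has_vector_derivative
      using f[OF u] f[OF s[OF u]] f[OF s[OF s[OF u]]] s[OF s[OF s[OF u]]] by simp
  qed (auto simp: has_real_derivative_iff_has_vector_derivative intro!: has_vector_derivative_Pair)
  then show ?thesis unfolding integral_curve_open[OF assms] phase_field_def by simp
qed

lemma solves_system_imp_integral_curve:
  assumes "open S" and "solves_system f \<beta> \<delta> S x y"
  shows "integral_curve (phase_field f \<beta> \<delta>) S (\<lambda>t. (x t, deriv x t, y t, deriv y t))"
  unfolding integral_curve_phase_field_iff[OF assms(1)]
proof
  fix t assume t: "t \<in> S"
  note s = assms(2)[unfolded solves_system_def, rule_format, OF t]
  have D: "(g has_real_derivative deriv g t) (at t)" if "g differentiable (at t)" for g :: "real \<Rightarrow> real"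
    using that by (simp add: DERIV_deriv_iff_real_differentiable)
  have "(x has_real_derivative deriv x t) (at t)" "(y has_real_derivative deriv y t) (at t)"
    "(deriv x has_real_derivative deriv (deriv x) t) (at t)"
    "(deriv y has_real_derivative deriv (deriv y) t) (at t)"
    using s by (auto intro: D)
  moreover have "deriv (deriv x) t = f (y t - x t) - \<beta> * (y t + x t)"
    "deriv (deriv y) t = f (y t - x t) - \<delta> * (y t + x t)" using s by linarith+
  ultimately show "(x has_real_derivative deriv x t) (at t) \<and>
       (deriv x has_real_derivative f (y t - x t) - \<beta> * (y t + x t)) (at t) \<and>
       (y has_real_derivative deriv y t) (at t) \<and>
       (deriv y has_real_derivative f (y t - x t) - \<delta> * (y t + x t)) (at t)" by simp
qed

lemma integral_curve_imp_solves_system: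
  assumes S: "open S"
    and u: "integral_curve (phase_field f \<beta> \<delta>) S (\<lambda>t. (x t, p t, y t, q t))"
  shows "solves_system f \<beta> \<delta> S x y"
  unfolding solves_system_def
proof
  fix t assume t: "t \<in> S"
  note D = u[unfolded integral_curve_phase_field_iff[OF S], rule_format]
  have eq: "deriv x r = p r" "deriv y r = q r" if "r \<in> S" for r
    using D[OF that] by (auto intro: DERIV_imp_deriv)
  have p': "(deriv x has_real_derivative f (y t - x t) - \<beta> * (y t + x t)) (at t)"
    by (rule has_field_derivative_transform_within_open[of p _ t S])
       (use D[OF t] S t eq in auto)
  have q': "(deriv y has_real_derivative f (y t - x t) - \<delta> * (y t + x t)) (at t)"
    by (rule has_field_derivative_transform_within_open[of q _ t S])
       (use D[OF t] S t eq in auto)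
  have diff: "g differentiable (at t)" if "(g has_real_derivative g') (at t)" for g g'
    using that real_differentiable_def by blast
  have x': "(x has_real_derivative p t) (at t)" and y': "(y has_real_derivative q t) (at t)"
    using D[OF t] by blast+
  show "x differentiable (at t) \<and> deriv x differentiable (at t) \<and>
      y differentiable (at t) \<and> deriv y differentiable (at t) \<and>
      deriv (deriv x) t - f (y t - x t) + \<beta> * (y t + x t) = 0 \<and>
      deriv (deriv y) t - f (y t - x t) + \<delta> * (y t + x t) = 0"
    using diff[OF x'] diff[OF p'] diff[OF y'] diff[OF q'] DERIV_imp_deriv[OF p'] DERIV_imp_deriv[OF q']
    by simp
qed

text \<open>In the variables \<open>w = y - x\<close> and \<open>z = y + x\<close> the nonlinearity drops out of the equation for
\<open>w\<close>. Since \<open>\<delta> > \<beta>\<close> and \<open>\<beta> + \<delta> \<le> 0\<close>, both coefficients have the signs required in the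
results on \<open>(w, z)\<close> above.\<close>

lemma difference_and_sum_equations:
  assumes "open S" and u: "integral_curve (phase_field f \<beta> \<delta>) S (\<lambda>t. (x t, p t, y t, q t))"
    and "t \<in> S"
  shows "((\<lambda>t. y t - x t) has_real_derivative q t - p t) (at t)"
    and "((\<lambda>t. q t - p t) has_real_derivative - ((\<delta> - \<beta>) * (y t + x t))) (at t)"
    and "((\<lambda>t. y t + x t) has_real_derivative q t + p t) (at t)"
    and "((\<lambda>t. q t + p t) has_real_derivative 2 * f (y t - x t) + (- (\<beta> + \<delta>)) * (y t + x t)) (at t)"
proof -
  note D = u[unfolded integral_curve_phase_field_iff[OF assms(1)], rule_format, OF assms(3)]
  show "((\<lambda>t. y t - x t) has_real_derivative q t - p t) (at t)"
    using D by (blast intro: DERIV_diff)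
  show "((\<lambda>t. y t + x t) has_real_derivative q t + p t) (at t)"
    using D by (blast intro: DERIV_add)
  show "((\<lambda>t. q t - p t) has_real_derivative - ((\<delta> - \<beta>) * (y t + x t))) (at t)"
    by (rule DERIV_cong[OF DERIV_diff]) (use D in \<open>auto simp: algebra_simps\<close>)
  show "((\<lambda>t. q t + p t) has_real_derivative 2 * f (y t - x t) + (- (\<beta> + \<delta>)) * (y t + x t)) (at t)"
    by (rule DERIV_cong[OF DERIV_add]) (use D in \<open>auto simp: algebra_simps\<close>)
qed

text \<open>A one-sided bound for \<open>x = (z - w) / 2\<close> or \<open>y = (z + w) / 2\<close> would bound the whole phase
curve.\<close>

lemma oscillation_of_unbounded_curve:
  fixes \<beta> \<delta> a R :: real and f x p y q :: "real \<Rightarrow> real"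
  assumes "\<beta> < \<delta>" "\<delta> \<le> - \<beta>" and f: "mono f" and "a < R"
    and u: "integral_curve (phase_field f \<beta> \<delta>) {a<..<R} (\<lambda>t. (x t, p t, y t, q t))"
    and unbounded: "\<And>M. \<not> (\<forall>\<^sub>F t in at_left R. norm (x t, p t, y t, q t) \<le> M)"
  shows "\<not> bdd_below_near x R" "\<not> bdd_below_near (\<lambda>t. - x t) R"
    "\<not> bdd_below_near y R" "\<not> bdd_below_near (\<lambda>t. - y t) R"
proof -
  have near: "\<forall>\<^sub>F t in at_left R. t \<in> {a<..<R}"
    using \<open>a < R\<close> by (auto simp: eventually_at_left_field)
  note D = difference_and_sum_equations[OF open_greaterThanLessThan u]
  have w: "deriv_near (\<lambda>t. y t - x t) (\<lambda>t. q t - p t) R"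
    unfolding deriv_near_def using near by eventually_elim (rule D)
  have w': "deriv_near (\<lambda>t. q t - p t) (\<lambda>t. - ((\<delta> - \<beta>) * (y t + x t))) R"
    unfolding deriv_near_def using near by eventually_elim (rule D)
  have z: "deriv_near (\<lambda>t. y t + x t) (\<lambda>t. q t + p t) R"
    unfolding deriv_near_def using near by eventually_elim (rule D)
  have z': "deriv_near (\<lambda>t. q t + p t) (\<lambda>t. 2 * f (y t - x t) + (- (\<beta> + \<delta>)) * (y t + x t)) R"
    unfolding deriv_near_def using near by eventually_elim (rule D)
  have main: False
    if g: "bdd_below_near g R" and \<epsilon>: "\<bar>\<epsilon>\<bar> = 1"
      and g_eq: "\<And>t. 2 * g t = \<epsilon> * (y t + x t) + \<eta> * (y t - x t)"
    for g and \<epsilon> \<eta> :: real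
  proof -
    obtain K where "\<forall>\<^sub>F t in at_left R. K \<le> g t" using g unfolding bdd_below_near_def by blast
    then have "\<forall>\<^sub>F t in at_left R. 2 * K \<le> \<epsilon> * (y t + x t) + \<eta> * (y t - x t)"
      unfolding g_eq[symmetric] by eventually_elim simp
    then have below: "bdd_below_near (\<lambda>t. \<epsilon> * (y t + x t) + \<eta> * (y t - x t)) R"
      by (rule bdd_below_nearI)
    have "bdd_near (\<lambda>t. y t - x t) R \<and> bdd_near (\<lambda>t. q t - p t) R \<and>
        bdd_near (\<lambda>t. y t + x t) R \<and> bdd_near (\<lambda>t. q t + p t) R"
      by (rule bdd_near_of_bdd_below_near_combination[OF _ _ f w w' z z' \<epsilon> below])
         (use assms(1,2) in auto)
    then obtain A B C E where b: "\<forall>\<^sub>F t in at_left R. \<bar>y t - x t\<bar> \<le> A"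
      "\<forall>\<^sub>F t in at_left R. \<bar>q t - p t\<bar> \<le> B"
      "\<forall>\<^sub>F t in at_left R. \<bar>y t + x t\<bar> \<le> C" "\<forall>\<^sub>F t in at_left R. \<bar>q t + p t\<bar> \<le> E"
      unfolding bdd_near_iff by blast
    have "\<forall>\<^sub>F t in at_left R. norm (x t, p t, y t, q t) \<le> 2 * A + 2 * B + 2 * C + 2 * E"
      using b
    proof eventually_elim
      case (elim t)
      have "norm (x t, p t, y t, q t) \<le> \<bar>x t\<bar> + (\<bar>p t\<bar> + (\<bar>y t\<bar> + \<bar>q t\<bar>))"
        using norm_Pair_le[of "x t" "(p t, y t, q t)"] norm_Pair_le[of "p t" "(y t, q t)"]
          norm_Pair_le[of "y t" "q t"] by simp
      moreover have "\<bar>x t\<bar> \<le> A + C" "\<bar>y t\<bar> \<le> A + C" "\<bar>p t\<bar> \<le> B + E" "\<bar>q t\<bar> \<le> B + E"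
        using elim by linarith+
      ultimately show ?case by linarith
    qed
    then show False using unbounded by blast
  qed
  show "\<not> bdd_below_near x R" using main[of x 1 "-1"] by auto
  show "\<not> bdd_below_near (\<lambda>t. - x t) R" using main[of "\<lambda>t. - x t" "-1" 1] by auto
  show "\<not> bdd_below_near y R" using main[of y 1 1] by auto
  show "\<not> bdd_below_near (\<lambda>t. - y t) R" using main[of "\<lambda>t. - y t" "-1" "-1"] by auto
qed

section \<open>Finite time blow-up with oscillations\<close>

theorem theorem16:
  fixes \<beta> \<delta> \<sigma> c d x\<^sub>0 y\<^sub>0 x\<^sub>1 y\<^sub>1 a b :: real
    and f x y :: "real \<Rightarrow> real"
  assumes "\<beta> < \<delta>" and "\<delta> \<le> - \<beta>"
    and "\<And>s. f s = \<sigma> * s + c * s^2 + d * s^3"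
    and "d > 0" and "c^2 \<le> 2 * d * \<sigma>"
    and "(3 * \<beta> - \<delta>) * x\<^sub>0 * y\<^sub>1 + (3 * \<delta> - \<beta>) * x\<^sub>1 * y\<^sub>0
           > (\<beta> + \<delta>) * (x\<^sub>0 * x\<^sub>1 + y\<^sub>0 * y\<^sub>1)"
    and "a < 0" and "0 < b"
    and "solves_system f \<beta> \<delta> {a<..<b} x y"
    and "x 0 = x\<^sub>0" and "deriv x 0 = x\<^sub>1" and "y 0 = y\<^sub>0" and "deriv y 0 = y\<^sub>1"
  shows "\<exists>R X Y. 0 < R \<and> maximal_forward_continuation f \<beta> \<delta> a b x y R X Y \<and>
           Liminf (at_left R) (\<lambda>t. ereal (X t)) = -\<infinity> \<and>
           Liminf (at_left R) (\<lambda>t. ereal (Y t)) = -\<infinity> \<and>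
           Limsup (at_left R) (\<lambda>t. ereal (X t)) = \<infinity> \<and>
           Limsup (at_left R) (\<lambda>t. ereal (Y t)) = \<infinity>"
proof -
  have f_eq: "f = (\<lambda>s. \<sigma> * s + c * s ^ 2 + d * s ^ 3)" using assms(3) by auto
  have f_mono: "mono f" unfolding f_eq using assms(4,5) by (rule cubic_mono)
  have V: "lipschitz_on_balls (phase_field f \<beta> \<delta>)"
    unfolding f_eq by (intro phase_field_lipschitz_on_balls cubic_lipschitz_on_balls)
  define u\<^sub>0 where "u\<^sub>0 t = (x t, deriv x t, y t, deriv y t)" for t
  have u\<^sub>0: "integral_curve (phase_field f \<beta> \<delta>) {a<..<b} u\<^sub>0"
    using solves_system_imp_integral_curve[OF open_greaterThanLessThan assms(9)]
    by (simp add: u\<^sub>0_def[abs_def])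
  define g where "g = (\<delta> - \<beta>) * ((y\<^sub>0 - x\<^sub>0) * (y\<^sub>1 + x\<^sub>1) - (y\<^sub>1 - x\<^sub>1) * (y\<^sub>0 + x\<^sub>0))
    + (- (\<beta> + \<delta>)) * (y\<^sub>0 - x\<^sub>0) * (y\<^sub>1 - x\<^sub>1)"
  have "g = (3 * \<beta> - \<delta>) * x\<^sub>0 * y\<^sub>1 + (3 * \<delta> - \<beta>) * x\<^sub>1 * y\<^sub>0 - (\<beta> + \<delta>) * (x\<^sub>0 * x\<^sub>1 + y\<^sub>0 * y\<^sub>1)"
    unfolding g_def by (simp add: algebra_simps)
  then have g: "g > 0" using assms(6) by simp
  define B where "B = 6 ^ 8 * ((9928 + 40 * (- (\<beta> + \<delta>))) ^ 2 / (4 * (2 * (\<delta> - \<beta>) * (d / 2)))) / g"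
  have B: "B \<ge> 0" unfolding B_def using g assms(1,4) by simp
  have bound: "r \<le> B + 2"
    if r: "b \<le> r" "integral_curve (phase_field f \<beta> \<delta>) {a<..<r} u" "\<forall>t\<in>{a<..<b}. u t = u\<^sub>0 t" for r u
  proof (rule ccontr)
    assume "\<not> r \<le> B + 2"
    obtain X p Y q where u: "u = (\<lambda>t. (X t, p t, Y t, q t))"
      by (rule that[of "\<lambda>t. fst (u t)" "\<lambda>t. fst (snd (u t))" "\<lambda>t. fst (snd (snd (u t)))"
            "\<lambda>t. snd (snd (snd (u t)))"]) simp
    have u0: "X 0 = x\<^sub>0" "p 0 = x\<^sub>1" "Y 0 = y\<^sub>0" "q 0 = y\<^sub>1"
      using r(3)[rule_format, of 0] assms(7,8,10-13) by (auto simp: u u\<^sub>0_def)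
    note D = difference_and_sum_equations[OF open_greaterThanLessThan r(2)[unfolded u]]
    have mem: "t \<in> {a<..<r}" if "t \<in> {0..B + 2}" for t
      using that \<open>\<not> r \<le> B + 2\<close> assms(7) by auto
    have "(B + 2) ^ 2 \<le> 6 ^ 8 * ((9928 + 40 * (- (\<beta> + \<delta>))) ^ 2 / (4 * (2 * (\<delta> - \<beta>) * (d / 2)))) / g"
      by (rule lifespan_bound[where f = f and w = "\<lambda>t. Y t - X t" and p = "\<lambda>t. q t - p t"
            and z = "\<lambda>t. Y t + X t" and q = "\<lambda>t. q t + p t"])
         (use assms(1,2,4) B g cubic_coercive[OF assms(4,5)] D[OF mem] u0
          in \<open>auto simp: f_eq g_def\<close>)
    then have "(B + 2) ^ 2 \<le> B" unfolding B_def[symmetric] .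
    moreover have "(B + 2) ^ 2 = B * B + 4 * B + 4" by (simp add: power2_eq_square algebra_simps)
    ultimately show False using B mult_nonneg_nonneg[OF B B] by linarith
  qed
  have "a < b" using assms(7,8) by simp
  obtain R u where R: "b \<le> R" "integral_curve (phase_field f \<beta> \<delta>) {a<..<R} u"
      "\<forall>t\<in>{a<..<b}. u t = u\<^sub>0 t"
    and max: "\<And>R' u'. R < R' \<Longrightarrow> integral_curve (phase_field f \<beta> \<delta>) {a<..<R'} u' \<Longrightarrow>
      (\<forall>t\<in>{a<..<b}. u' t = u\<^sub>0 t) \<Longrightarrow> False"
    and unbounded: "\<And>M. \<not> (\<forall>\<^sub>F t in at_left R. norm (u t) \<le> M)"
    by (rule maximal_integral_curve[OF V \<open>a < b\<close> u\<^sub>0, where L = "B + 2"])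
       (erule (2) bound, rule that, assumption+)
  obtain X p Y q where u: "u = (\<lambda>t. (X t, p t, Y t, q t))"
    by (rule that[of "\<lambda>t. fst (u t)" "\<lambda>t. fst (snd (u t))" "\<lambda>t. fst (snd (snd (u t)))"
          "\<lambda>t. snd (snd (snd (u t)))"]) simp
  have "maximal_forward_continuation f \<beta> \<delta> a b x y R X Y"
    unfolding maximal_forward_continuation_def
  proof (intro conjI notI)
    show "b \<le> R" by (rule R)
    show "solves_system f \<beta> \<delta> {a<..<R} X Y"
      using integral_curve_imp_solves_system[OF open_greaterThanLessThan R(2)[unfolded u]] .
    show XY: "\<forall>t\<in>{a<..<b}. X t = x t \<and> Y t = y t" using R(3) by (simp add: u u\<^sub>0_def)
    assume "\<exists>R' X' Y'. R < R' \<and> solves_system f \<beta> \<delta> {a<..<R'} X' Y' \<and>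
          (\<forall>t\<in>{a<..<R}. X' t = X t \<and> Y' t = Y t)"
    then obtain R' X' Y' where R': "R < R'" and sol: "solves_system f \<beta> \<delta> {a<..<R'} X' Y'"
      and eq: "\<forall>t\<in>{a<..<R}. X' t = X t \<and> Y' t = Y t" by blast
    have agree: "X' t = x t" "Y' t = y t" if "t \<in> {a<..<b}" for t
      using that eq XY R(1) by auto
    have "deriv X' t = deriv x t" "deriv Y' t = deriv y t" if t: "t \<in> {a<..<b}" for t
    proof -
      have "\<forall>\<^sub>F s in nhds t. s \<in> {a<..<b}" using t by (intro eventually_nhds_in_open) auto
      then have "\<forall>\<^sub>F s in nhds t. X' s = x s" "\<forall>\<^sub>F s in nhds t. Y' s = y s"
        by (auto elim!: eventually_mono simp: agree)
      then show "deriv X' t = deriv x t" "deriv Y' t = deriv y t"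
        by (simp_all add: deriv_cong_ev)
    qed
    then have "\<forall>t\<in>{a<..<b}. (X' t, deriv X' t, Y' t, deriv Y' t) = u\<^sub>0 t"
      using agree by (simp add: u\<^sub>0_def)
    then show False
      using max[OF R' solves_system_imp_integral_curve[OF open_greaterThanLessThan sol]] by blast
  qed
  moreover have "0 < R" using R(1) assms(8) by simp
  moreover have "a < R" using R(1) \<open>a < b\<close> by simp
  note osc = oscillation_of_unbounded_curve[OF assms(1,2) f_mono \<open>a < R\<close> R(2)[unfolded u]
      unbounded[unfolded u]]
  have "Liminf (at_left R) (\<lambda>t. ereal (X t)) = -\<infinity>" "Liminf (at_left R) (\<lambda>t. ereal (Y t)) = -\<infinity>"
    "Limsup (at_left R) (\<lambda>t. ereal (X t)) = \<infinity>" "Limsup (at_left R) (\<lambda>t. ereal (Y t)) = \<infinity>"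
    using osc by (blast intro: Liminf_at_left_eq_minus_infinity Limsup_at_left_eq_infinity)+
  ultimately show ?thesis by blast
qed

end
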